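(* Let $\mathbf{H}_0=\epsilon_a\mathbf{a}+\bar\epsilon_a\mathbf{a}^\dagger+\epsilon_0\mathbf{K}_0+\epsilon_+\mathbf{K}_++\epsilon_-\mathbf{K}_-$ with (possibly time-dependent) coefficients satisfying $\bar\epsilon_+=\epsilon_-$ and $\epsilon_0=\bar\epsilon_0$; define the real coefficients $\nu_1,\nu_2,\varepsilon_0,\varepsilon_1,\varepsilon_2$ by $\epsilon_a=\nu_1+i\nu_2$, $\epsilon_0=2\varepsilon_0$, $\epsilon_+=\varepsilon_1-i\varepsilon_2$, so that equivalently $\mathbf{H}_0=2\varepsilon_0\mathbf{K}_0+2\varepsilon_1\mathbf{K}_1+2\varepsilon_2\mathbf{K}_2+\nu_1\mathbf{N}_1+\nu_2\mathbf{N}_2$. A dot denotes the derivative with respect to $\tau=t/\hbar$. Let $\Phi\in\mathfrak{H}$ satisfy $\mathbf{K}_0\Phi=k\Phi$. Suppose that the real functions $x,y$, the functions $u,v$ with $u^2+v^2<1$, and the real phase $\varphi$ satisfy $$\dot x=-\varepsilon_2x+(\varepsilon_0-\varepsilon_1)y-\nu_2,\qquad \dot y=-(\varepsilon_0+\varepsilon_1)x+\varepsilon_2y-\nu_1,$$ $$\dot u=2v(\varepsilon_1u+\varepsilon_0)-\varepsilon_2(1-u^2+v^2),\qquad \dot v=2u(\varepsilon_2v-\varepsilon_0)-\varepsilon_1(1+u^2-v^2),$$ $$\dot\varphi=\nu_1x-\nu_2y+2k(\varepsilon_0+\varepsilon_1u-\varepsilon_2v).$$ Put $\xi=(\alpha,w)$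 with $\alpha=x+iy$ and $w=u+iv$. Then $\Psi=e^{-i\varphi}T(\xi)\Phi$ is a solution of the time-dependent Schrödinger equation $$\mathbf{H}_0\Psi=i\hbar\frac{d\Psi}{dt}.$$ Moreover, the equations for $(u,v)$ are, in the complex variable $w=u+iv$ with $|w|<1$, the Riccati equation $$i\dot w=\epsilon_++\epsilon_0w+\epsilon_-w^2,$$ and the equations for $(x,y)$ are, in the complex variable $\eta=x+iy$, the equation $$i\dot\eta=\bar\epsilon_a+\epsilon_+\bar\eta+\frac{\epsilon_0}{2}\eta.$$
   Context: The Jacobi algebra $\mathfrak{g}^J_1=\mathfrak{h}_1\rtimes\mathfrak{su}(1,1)$ is the real Lie algebra consisting of the elements $i sI+\alpha a^\dagger-\bar\alpha a+2i\theta K_0+yK_+-\bar yK_-$ ($s,\theta\in\mathbb{R}$, $\alpha,y\in\mathbb{C}$), where $I$ is central and the generators satisfy $[a,a^\dagger]=I$; $[K_0,K_\pm]=\pm K_\pm$, $[K_-,K_+]=2K_0$; $[a,K_+]=a^\dagger$, $[K_-,a^\dagger]=a$, $[K_+,a^\dagger]=[K_-,a]=0$; $[K_0,a^\dagger]=\tfrac12a^\dagger$, $[K_0,a]=-\tfrac12a$. The Jacobi group is $G^J_1=H_1\rtimes\mathrm{SU}(1,1)$, with $H_1$ the 3-dimensional Heisenberg group. Fix a continuous unitary irreducible representation $\pi$ of $G^J_1$ on a separable complex Hilbert space $\mathfrak{H}$, with $I$ acting as the identity operator, possessing a cyclic lowest weight vector $e_0$: $\mathbf{a}e_0=0$, $\mathbf{K}_-e_0=0$,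 and $e_0$ is an eigenvector of $\mathbf{K}_0$ with positive eigenvalue (positive discrete series type). Boldface $\mathbf{X}$ denotes the operator of the derived representation $d\pi$ (extended complex-linearly) corresponding to $X$, defined on smooth vectors; $\mathbf{a}^\dagger$ is the adjoint of $\mathbf{a}$, $\mathbf{K}_+$ the adjoint of $\mathbf{K}_-$, and $\mathbf{K}_0$ is symmetric. Real combinations: $\mathbf{N}_1=\mathbf{a}+\mathbf{a}^\dagger$, $\mathbf{N}_2=i(\mathbf{a}-\mathbf{a}^\dagger)$, $\mathbf{K}_1=\tfrac12(\mathbf{K}_++\mathbf{K}_-)$, $\mathbf{K}_2=\tfrac1{2i}(\mathbf{K}_+-\mathbf{K}_-)$. The Siegel disk is $\mathcal{D}_1=\{w\in\mathbb{C}:|w|<1\}$ and the Siegel-Jacobi disk is $\mathcal{D}^J_1=\mathbb{C}\times\mathcal{D}_1$. For $\xi=(\alpha,w)\in\mathbb{C}\times\mathcal{D}_1$ the unitary operator $T(\xi)$ is $T(\xi)=D(\alpha)S(w)$, where $D(\alpha)=\exp(\alpha\mathbf{a}^\dagger-\bar\alpha\mathbf{a})$ and $S(w)=\exp(\zeta\mathbf{K}_+-\bar\zeta\mathbf{K}_-)$, with $\zeta\in\mathbb{C}$ determined by $w=\frac{\zeta}{|\zeta|}\tanh|\zeta|$ ($\zeta=0$ if $w=0$); equivalently $S(w)=\exp(w\mathbf{K}_+)\exp(\ln(1-w\bar w)\mathbf{K}_0)\exp(-\bar w\mathbf{K}_-)$. *)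

theory Defs
  imports "HOL-Analysis.Analysis" "HOL-Algebra.Group"
begin

section \<open>Complex Hilbert spaces\<close>

text \<open>\<open>cinner\<close> is antilinear in the first argument; its real part is the inner product
  of the underlying real Hilbert space, so that norm and topology are the library's.\<close>

class complex_hilbert_space = banach + real_inner +
  fixes scaleC :: "complex \<Rightarrow> 'a \<Rightarrow> 'a"  (infixr "*\<^sub>C" 75)
    and cinner :: "'a \<Rightarrow> 'a \<Rightarrow> complex"
  assumes scaleC_add_right: "c *\<^sub>C (x + y) = c *\<^sub>C x + c *\<^sub>C y"
    and scaleC_add_left: "(c + d) *\<^sub>C x = c *\<^sub>C x + d *\<^sub>C x"
    and scaleC_scaleC: "c *\<^sub>C (d *\<^sub>C x) = (c * d) *\<^sub>C x"
    and scaleC_of_real: "complex_of_real r *\<^sub>C x = r *\<^sub>R x"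
    and cinner_commute: "cinner x y = cnj (cinner y x)"
    and cinner_add_right: "cinner x (y + z) = cinner x y + cinner x z"
    and cinner_scaleC_right: "cinner x (c *\<^sub>C y) = c * cinner x y"
    and Re_cinner: "Re (cinner x y) = inner x y"

instantiation complex :: complex_hilbert_space
begin
definition "c *\<^sub>C (x::complex) = c * x"
definition "cinner (x::complex) y = cnj x * y"
instance
  by standard (auto simp: scaleC_complex_def cinner_complex_def algebra_simps
      inner_complex_def scaleR_conv_of_real)
end

definition separable_hilbert :: "'h::complex_hilbert_space itself \<Rightarrow> bool" where
  "separable_hilbert _ \<longleftrightarrow> (\<exists>A::'h set. countable A \<and> closure A = UNIV)"

definition csubspace :: "'h::complex_hilbert_space set \<Rightarrow> bool" where
  "csubspace M \<longleftrightarrow> 0 \<in> M \<and> (\<forall>x\<in>M. \<forall>y\<in>M. x + y \<in> M) \<and> (\<forall>c. \<forall>x\<in>M. c *\<^sub>C x \<in> M)"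

definition unitary_op :: "('h::complex_hilbert_space \<Rightarrow> 'h) \<Rightarrow> bool" where
  "unitary_op U \<longleftrightarrow>
     (\<forall>x y. U (x + y) = U x + U y) \<and> (\<forall>c x. U (c *\<^sub>C x) = c *\<^sub>C U x) \<and>
     surj U \<and> (\<forall>x y. cinner (U x) (U y) = cinner x y)"

definition unitary_group :: "(real \<Rightarrow> 'h::complex_hilbert_space \<Rightarrow> 'h) \<Rightarrow> bool" where
  "unitary_group U \<longleftrightarrow>
     (\<forall>t. unitary_op (U t)) \<and> (\<forall>s t. U (s + t) = U s \<circ> U t) \<and>
     (\<forall>v. continuous_on UNIV (\<lambda>t. U t v))"

text \<open>The exponential of an unbounded operator \<open>A\<close> with domain \<open>D\<close>, in the sense of Stone's
  theorem: the time-one value of the strongly continuous one-parameter unitary group whose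
  generator extends \<open>A\<close> on \<open>D\<close>. That group is unique when \<open>A\<close> is essentially skew-adjoint on
  \<open>D\<close>, which is the only situation in which the definition is used.\<close>

definition op_exp :: "'h::complex_hilbert_space set \<Rightarrow> ('h \<Rightarrow> 'h) \<Rightarrow> 'h \<Rightarrow> 'h" where
  "op_exp D A =
     (THE U. unitary_group U \<and> (\<forall>v\<in>D. ((\<lambda>t. U t v) has_vector_derivative A v) (at 0))) 1"


section \<open>The Jacobi group\<close>

definition mat2 :: "complex \<Rightarrow> complex \<Rightarrow> complex \<Rightarrow> complex \<Rightarrow> complex^2^2" where
  "mat2 a b c d = vector [vector [a, b], vector [c, d]]"

definition SU11 :: "(complex^2^2) set" where
  "SU11 = {g. (\<chi> i j. cnj (g $ j $ i)) ** mat2 1 0 0 (-1) ** g = mat2 1 0 0 (-1) \<and> det g = 1}"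

text \<open>The real-linear action on \<open>\<complex>\<close>, the first component of \<open>A\<close> applied to \<open>(\<alpha>, cnj \<alpha>)\<close>; used
  both for the group and for its Lie algebra.\<close>

definition mat_act :: "complex^2^2 \<Rightarrow> complex \<Rightarrow> complex" where
  "mat_act A \<alpha> = A $ 1 $ 1 * \<alpha> + A $ 1 $ 2 * cnj \<alpha>"

text \<open>\<open>((\<alpha>, s), g)\<close> stands for \<open>exp (isI + \<alpha> a\<^sup>\<dagger> - cnj \<alpha> a) \<cdot> g\<close>, with \<open>(\<alpha>, s)\<close> in the Heisenberg
  group. Since \<open>[\<alpha> a\<^sup>\<dagger> - cnj \<alpha> a, \<beta> a\<^sup>\<dagger> - cnj \<beta> a] = 2i Im (\<alpha> cnj \<beta>) I\<close>, the cocycle is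
  \<open>Im (\<alpha> cnj \<beta>)\<close>.\<close>

type_synonym jacobi = "(complex \<times> real) \<times> (complex^2^2)"

definition heis_mult :: "complex \<times> real \<Rightarrow> complex \<times> real \<Rightarrow> complex \<times> real" where
  "heis_mult h h' = (fst h + fst h', snd h + snd h' + Im (fst h * cnj (fst h')))"

definition jacobi_group :: "jacobi monoid" where
  "jacobi_group =
     \<lparr>carrier = UNIV \<times> SU11,
      mult = (\<lambda>(h, g) (h', g'). (heis_mult h (mat_act g (fst h'), snd h'), g ** g')),
      one = ((0, 0), mat 1)\<rparr>"

lemma mat2_nth [simp]:
  "mat2 a b c d $ 1 $ 1 = a" "mat2 a b c d $ 1 $ 2 = b"
  "mat2 a b c d $ 2 $ 1 = c" "mat2 a b c d $ 2 $ 2 = d"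
  by (simp_all add: mat2_def)

lemma mat2_eq_iff:
  "(A::complex^2^2) = B \<longleftrightarrow>
     A $ 1 $ 1 = B $ 1 $ 1 \<and> A $ 1 $ 2 = B $ 1 $ 2 \<and> A $ 2 $ 1 = B $ 2 $ 1 \<and> A $ 2 $ 2 = B $ 2 $ 2"
  by (auto simp: vec_eq_iff forall_2)

lemma mat2_mult: "mat2 a b c d ** mat2 a' b' c' d' =
    mat2 (a * a' + b * c') (a * b' + b * d') (c * a' + d * c') (c * b' + d * d')"
  by (simp add: mat2_eq_iff matrix_matrix_mult_def sum_2)

lemma SU11_eq: "SU11 = {mat2 p q (cnj q) (cnj p) | p q. p * cnj p - q * cnj q = 1}"
proof (intro Set.set_eqI iffI)
  fix g :: "complex^2^2"
  assume g: "g \<in> SU11"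
  obtain a b c d where gd: "g = mat2 a b c d"
    by (metis mat2_eq_iff mat2_nth)
  have det: "a * d - b * c = 1"
    using g by (simp add: SU11_def gd det_2)
  have eqs: "cnj a * a - cnj c * c = 1" "cnj a * b - cnj c * d = 0" "cnj b * b - cnj d * d = -1"
    using g by (auto simp: SU11_def gd mat2_eq_iff matrix_matrix_mult_def sum_2)
  have "cnj a = cnj a * (a * d - b * c)" using det by simp
  also have "\<dots> = d * (cnj a * a - cnj c * c) - c * (cnj a * b - cnj c * d)" by algebra
  finally have d: "d = cnj a" using eqs by simp
  have "cnj c = cnj c * (a * d - b * c)" using det by simp
  also have "\<dots> = b * (cnj a * a - cnj c * c) - a * (cnj a * b - cnj c * d)" by algebra
  finally have b: "b = cnj c" using eqs by simp
  show "g \<in> {mat2 p q (cnj q) (cnj p) | p q. p * cnj p - q * cnj q = 1}"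
    unfolding mem_Collect_eq using det d b gd by (intro exI[of _ a] exI[of _ b]) simp
next
  fix g :: "complex^2^2"
  assume "g \<in> {mat2 p q (cnj q) (cnj p) | p q. p * cnj p - q * cnj q = 1}"
  then obtain p q where "g = mat2 p q (cnj q) (cnj p)" "p * cnj p - q * cnj q = 1" by blast
  then show "g \<in> SU11"
    by (simp add: SU11_def mat2_eq_iff matrix_matrix_mult_def sum_2 det_2 algebra_simps)
qed

lemma SU11_mult: "g \<in> SU11 \<Longrightarrow> h \<in> SU11 \<Longrightarrow> g ** h \<in> SU11"
proof -
  assume "g \<in> SU11" "h \<in> SU11"
  then obtain p q r s where
    g: "g = mat2 p q (cnj q) (cnj p)" "p * cnj p - q * cnj q = 1" and
    h: "h = mat2 r s (cnj s) (cnj r)" "r * cnj r - s * cnj s = 1"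
    unfolding SU11_eq by blast
  let ?x = "p * r + q * cnj s" and ?y = "p * s + q * cnj r"
  have "?x * cnj ?x - ?y * cnj ?y = (p * cnj p - q * cnj q) * (r * cnj r - s * cnj s)"
    by (simp add: algebra_simps)
  moreover have "g ** h = mat2 ?x ?y (cnj ?y) (cnj ?x)"
    by (simp add: g h mat2_mult mat2_eq_iff algebra_simps)
  ultimately show ?thesis
    unfolding SU11_eq mem_Collect_eq using g(2) h(2)
    by (intro exI[of _ ?x] exI[of _ ?y]) simp
qed

lemma group_jacobi_group: "group jacobi_group"
proof (rule groupI)
  show "\<one>\<^bsub>jacobi_group\<^esub> \<in> carrier jacobi_group"
    by (auto simp: jacobi_group_def SU11_eq mat2_eq_iff mat_def intro!: exI[of _ 1])
next
  fix x y assume "x \<in> carrier jacobi_group" "y \<in> carrier jacobi_group"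
  then show "x \<otimes>\<^bsub>jacobi_group\<^esub> y \<in> carrier jacobi_group"
    by (auto simp: jacobi_group_def SU11_mult)
next
  fix x y z
  assume "x \<in> carrier jacobi_group" "y \<in> carrier jacobi_group" "z \<in> carrier jacobi_group"
  then obtain \<alpha> \<beta> \<gamma> r s t g h k where
    x: "x = ((\<alpha>, r), g)" "g \<in> SU11" and y: "y = ((\<beta>, s), h)" "h \<in> SU11" and
    z: "z = ((\<gamma>, t), k)" "k \<in> SU11"
    by (auto simp: jacobi_group_def)
  obtain p q where g: "g = mat2 p q (cnj q) (cnj p)" "p * cnj p - q * cnj q = 1"
    using x unfolding SU11_eq by blast
  obtain p' q' where h: "h = mat2 p' q' (cnj q') (cnj p')"
    using y unfolding SU11_eq by blast
  have act: "mat_act (g ** h) c = mat_act g (mat_act h c)" for c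
    by (simp add: mat_act_def g h mat2_mult algebra_simps)
  have "mat_act g \<beta> * cnj (mat_act g c) - cnj (mat_act g \<beta>) * mat_act g c
      = (p * cnj p - q * cnj q) * (\<beta> * cnj c - cnj \<beta> * c)" for c
    by (simp add: mat_act_def g(1) algebra_simps)
  then have "Im (mat_act g \<beta> * cnj (mat_act g c)) = Im (\<beta> * cnj c)" for c
  proof -
    assume "\<And>c. mat_act g \<beta> * cnj (mat_act g c) - cnj (mat_act g \<beta>) * mat_act g c
      = (p * cnj p - q * cnj q) * (\<beta> * cnj c - cnj \<beta> * c)"
    from arg_cong[OF this[of c], of Im] show ?thesis
      by (simp add: g(2) algebra_simps)
  qed
  moreover have "mat_act g (b + c) = mat_act g b + mat_act g c" for b c
    by (simp add: mat_act_def algebra_simps)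
  ultimately show "x \<otimes>\<^bsub>jacobi_group\<^esub> y \<otimes>\<^bsub>jacobi_group\<^esub> z
      = x \<otimes>\<^bsub>jacobi_group\<^esub> (y \<otimes>\<^bsub>jacobi_group\<^esub> z)"
    by (simp add: x y z jacobi_group_def heis_mult_def act matrix_mul_assoc ring_distribs)
next
  fix x assume "x \<in> carrier jacobi_group"
  then show "\<one>\<^bsub>jacobi_group\<^esub> \<otimes>\<^bsub>jacobi_group\<^esub> x = x"
    by (auto simp: jacobi_group_def heis_mult_def mat_act_def mat_def split: prod.splits)
      (simp add: mat_def[symmetric])
next
  fix x assume "x \<in> carrier jacobi_group"
  then obtain \<alpha> s p q where x: "x = ((\<alpha>, s), mat2 p q (cnj q) (cnj p))"
    and pq: "p * cnj p - q * cnj q = 1"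
    by (auto simp: jacobi_group_def SU11_eq)
  let ?h = "mat2 (cnj p) (- q) (- cnj q) p"
  have inv: "?h ** mat2 p q (cnj q) (cnj p) = mat 1"
    using pq by (simp add: mat2_mult mat2_eq_iff mat_def algebra_simps)
  have h: "?h \<in> SU11"
    unfolding SU11_eq mem_Collect_eq using pq
    by (intro exI[of _ "cnj p"] exI[of _ "- q"]) (simp add: algebra_simps)
  let ?y = "((- mat_act ?h \<alpha>, - s), ?h)"
  have "?y \<otimes>\<^bsub>jacobi_group\<^esub> x = \<one>\<^bsub>jacobi_group\<^esub>"
    by (simp add: x jacobi_group_def heis_mult_def inv)
  moreover have "?y \<in> carrier jacobi_group"
    using h by (simp add: jacobi_group_def)
  ultimately show "\<exists>y\<in>carrier jacobi_group. y \<otimes>\<^bsub>jacobi_group\<^esub> x = \<one>\<^bsub>jacobi_group\<^esub>"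
    by blast
qed


section \<open>The Jacobi algebra\<close>

text \<open>The Lie algebra is the tangent space at the identity, a real subspace of the type \<open>jacobi\<close>.
  \<open>jacobi_elem s \<alpha> \<theta> y\<close> is \<open>isI + \<alpha> a\<^sup>\<dagger> - cnj \<alpha> a + 2i\<theta> K\<^sub>0 + y K\<^sub>+ - cnj y K\<^sub>-\<close>, in the realization
  \<open>K\<^sub>0 = diag (1/2, -1/2)\<close>, \<open>K\<^sub>+ = E\<^sub>1\<^sub>2\<close>, \<open>K\<^sub>- = - E\<^sub>2\<^sub>1\<close> of the complexification of \<open>su(1,1)\<close>.\<close>

definition jacobi_elem :: "real \<Rightarrow> complex \<Rightarrow> real \<Rightarrow> complex \<Rightarrow> jacobi" where
  "jacobi_elem s \<alpha> \<theta> y = ((\<alpha>, s), mat2 (\<i> * \<theta>) y (cnj y) (- \<i> * \<theta>))"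

text \<open>An element \<open>X + iY\<close> of the complexification is represented by the pair \<open>(X, Y)\<close>.\<close>

definition cscale :: "complex \<Rightarrow> jacobi \<times> jacobi \<Rightarrow> jacobi \<times> jacobi" where
  "cscale c Z = (Re c *\<^sub>R fst Z - Im c *\<^sub>R snd Z, Im c *\<^sub>R fst Z + Re c *\<^sub>R snd Z)"

definition gen_I :: "jacobi \<times> jacobi" where
  "gen_I = (0, jacobi_elem (-1) 0 0 0)"

definition gen_a :: "jacobi \<times> jacobi" where
  "gen_a = (jacobi_elem 0 (-1/2) 0 0, jacobi_elem 0 (-\<i>/2) 0 0)"

definition gen_ad :: "jacobi \<times> jacobi" where
  "gen_ad = (jacobi_elem 0 (1/2) 0 0, jacobi_elem 0 (-\<i>/2) 0 0)"

definition gen_K0 :: "jacobi \<times> jacobi" where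
  "gen_K0 = (0, jacobi_elem 0 0 (-1/2) 0)"

definition gen_Kp :: "jacobi \<times> jacobi" where
  "gen_Kp = (jacobi_elem 0 0 0 (1/2), jacobi_elem 0 0 0 (-\<i>/2))"

definition gen_Km :: "jacobi \<times> jacobi" where
  "gen_Km = (jacobi_elem 0 0 0 (-1/2), jacobi_elem 0 0 0 (-\<i>/2))"

lemmas gen_defs = gen_I_def gen_a_def gen_ad_def gen_K0_def gen_Kp_def gen_Km_def

text \<open>The general element of the Jacobi algebra and the commutation relations, as a check of the
  conventions. The bracket is the one of the semidirect product \<open>jacobi_group\<close>.\<close>

lemma jacobi_elem_generators:
  "(jacobi_elem s \<alpha> \<theta> y, 0) =
     cscale (\<i> * s) gen_I + cscale \<alpha> gen_ad - cscale (cnj \<alpha>) gen_a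
     + cscale (2 * \<i> * \<theta>) gen_K0 + cscale y gen_Kp - cscale (cnj y) gen_Km"
  by (simp add: gen_defs cscale_def jacobi_elem_def mat2_eq_iff complex_eq_iff prod_eq_iff)

definition jacobi_bracket :: "jacobi \<Rightarrow> jacobi \<Rightarrow> jacobi" where
  "jacobi_bracket X Y =
     ((mat_act (snd X) (fst (fst Y)) - mat_act (snd Y) (fst (fst X)),
       2 * Im (fst (fst X) * cnj (fst (fst Y)))),
      snd X ** snd Y - snd Y ** snd X)"

definition cbracket :: "jacobi \<times> jacobi \<Rightarrow> jacobi \<times> jacobi \<Rightarrow> jacobi \<times> jacobi" where
  "cbracket Z W =
     (jacobi_bracket (fst Z) (fst W) - jacobi_bracket (snd Z) (snd W),
      jacobi_bracket (fst Z) (snd W) + jacobi_bracket (snd Z) (fst W))"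

lemma jacobi_relations:
  "cbracket gen_a gen_ad = gen_I"
  "cbracket gen_K0 gen_Kp = gen_Kp"
  "cbracket gen_K0 gen_Km = - gen_Km"
  "cbracket gen_Km gen_Kp = cscale 2 gen_K0"
  "cbracket gen_a gen_Kp = gen_ad"
  "cbracket gen_Km gen_ad = gen_a"
  "cbracket gen_Kp gen_ad = 0"
  "cbracket gen_Km gen_a = 0"
  "cbracket gen_K0 gen_ad = cscale (1/2) gen_ad"
  "cbracket gen_K0 gen_a = cscale (-1/2) gen_a"
  "cbracket gen_I gen_a = 0" "cbracket gen_I gen_ad = 0" "cbracket gen_I gen_K0 = 0"
  "cbracket gen_I gen_Kp = 0" "cbracket gen_I gen_Km = 0"
  by (simp_all add: cbracket_def jacobi_bracket_def gen_defs cscale_def jacobi_elem_def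
      mat_act_def mat2_eq_iff matrix_matrix_mult_def sum_2 complex_eq_iff prod_eq_iff)


section \<open>Smooth vectors and the derived representation\<close>

primrec higher_differentiable_on ::
  "('a::real_normed_vector) set \<Rightarrow> ('a \<Rightarrow> 'b::real_normed_vector) \<Rightarrow> nat \<Rightarrow> bool" where
  "higher_differentiable_on S f 0 \<longleftrightarrow> continuous_on S f"
| "higher_differentiable_on S f (Suc n) \<longleftrightarrow>
     (\<forall>x\<in>S. f differentiable (at x)) \<and>
     (\<forall>v. higher_differentiable_on S (\<lambda>x. frechet_derivative f (at x) v) n)"

definition smooth_on_open :: "('a::real_normed_vector) set \<Rightarrow> ('a \<Rightarrow> 'b::real_normed_vector) \<Rightarrow> bool"
  where "smooth_on_open S f \<longleftrightarrow> open S \<and> (\<forall>n. higher_differentiable_on S f n)"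

text \<open>The orbit map of \<open>v\<close> is smooth on the embedded submanifold \<open>carrier jacobi_group\<close>, i.e.
  locally the restriction of a smooth map on an open set of the surrounding vector space.\<close>

definition smooth_vectors :: "(jacobi \<Rightarrow> 'h::complex_hilbert_space \<Rightarrow> 'h) \<Rightarrow> 'h set" where
  "smooth_vectors \<pi> =
     {v. \<forall>g\<in>carrier jacobi_group. \<exists>S F. g \<in> S \<and> smooth_on_open S F \<and>
           (\<forall>h\<in>S \<inter> carrier jacobi_group. \<pi> h v = F h)}"

definition exp_curve :: "jacobi \<Rightarrow> real \<Rightarrow> jacobi" where
  "exp_curve X = (THE \<gamma>. (\<forall>t. \<gamma> t \<in> carrier jacobi_group) \<and>
     (\<forall>s t. \<gamma> (s + t) = \<gamma> s \<otimes>\<^bsub>jacobi_group\<^esub> \<gamma> t) \<and> (\<gamma> has_vector_derivative X) (at 0))"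

definition dpi :: "(jacobi \<Rightarrow> 'h::complex_hilbert_space \<Rightarrow> 'h) \<Rightarrow> jacobi \<Rightarrow> 'h \<Rightarrow> 'h" where
  "dpi \<pi> X v = vector_derivative (\<lambda>t. \<pi> (exp_curve X t) v) (at 0)"

definition dpi_C :: "(jacobi \<Rightarrow> 'h::complex_hilbert_space \<Rightarrow> 'h) \<Rightarrow> jacobi \<times> jacobi \<Rightarrow> 'h \<Rightarrow> 'h" where
  "dpi_C \<pi> Z v = dpi \<pi> (fst Z) v + \<i> *\<^sub>C dpi \<pi> (snd Z) v"

text \<open>The following operators are meaningful on \<open>smooth_vectors \<pi>\<close> only.\<close>

definition op_I where "op_I \<pi> = dpi_C \<pi> gen_I"
definition op_a where "op_a \<pi> = dpi_C \<pi> gen_a"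
definition op_ad where "op_ad \<pi> = dpi_C \<pi> gen_ad"
definition op_K0 where "op_K0 \<pi> = dpi_C \<pi> gen_K0"
definition op_Kp where "op_Kp \<pi> = dpi_C \<pi> gen_Kp"
definition op_Km where "op_Km \<pi> = dpi_C \<pi> gen_Km"

definition op_N1 where "op_N1 \<pi> v = op_a \<pi> v + op_ad \<pi> v"
definition op_N2 where "op_N2 \<pi> v = \<i> *\<^sub>C (op_a \<pi> v - op_ad \<pi> v)"
definition op_K1 where "op_K1 \<pi> v = (1/2) *\<^sub>C (op_Kp \<pi> v + op_Km \<pi> v)"
definition op_K2 where "op_K2 \<pi> v = (1/(2 * \<i>)) *\<^sub>C (op_Kp \<pi> v - op_Km \<pi> v)"


section \<open>Representations of positive discrete series type\<close>

definition unitary_rep :: "(jacobi \<Rightarrow> 'h::complex_hilbert_space \<Rightarrow> 'h) \<Rightarrow> bool" where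
  "unitary_rep \<pi> \<longleftrightarrow>
     (\<forall>g\<in>carrier jacobi_group. unitary_op (\<pi> g)) \<and>
     (\<forall>g\<in>carrier jacobi_group. \<forall>h\<in>carrier jacobi_group.
        \<pi> (g \<otimes>\<^bsub>jacobi_group\<^esub> h) = \<pi> g \<circ> \<pi> h) \<and>
     (\<forall>v. continuous_on (carrier jacobi_group) (\<lambda>g. \<pi> g v))"

definition irreducible_rep :: "(jacobi \<Rightarrow> 'h::complex_hilbert_space \<Rightarrow> 'h) \<Rightarrow> bool" where
  "irreducible_rep \<pi> \<longleftrightarrow>
     (\<exists>v::'h. v \<noteq> 0) \<and>
     (\<forall>M. csubspace M \<and> closed M \<and> (\<forall>g\<in>carrier jacobi_group. \<forall>v\<in>M. \<pi> g v \<in> M)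
        \<longrightarrow> M = {0} \<or> M = UNIV)"

definition cyclic_vector :: "(jacobi \<Rightarrow> 'h::complex_hilbert_space \<Rightarrow> 'h) \<Rightarrow> 'h \<Rightarrow> bool" where
  "cyclic_vector \<pi> v \<longleftrightarrow>
     closure (span {c *\<^sub>C \<pi> g v | c g. g \<in> carrier jacobi_group}) = UNIV"

definition lowest_weight_vector :: "(jacobi \<Rightarrow> 'h::complex_hilbert_space \<Rightarrow> 'h) \<Rightarrow> 'h \<Rightarrow> bool" where
  "lowest_weight_vector \<pi> e \<longleftrightarrow>
     e \<noteq> 0 \<and> e \<in> smooth_vectors \<pi> \<and> op_a \<pi> e = 0 \<and> op_Km \<pi> e = 0 \<and>
     (\<exists>k>0. op_K0 \<pi> e = complex_of_real k *\<^sub>C e)"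

definition positive_discrete_rep :: "(jacobi \<Rightarrow> 'h::complex_hilbert_space \<Rightarrow> 'h) \<Rightarrow> bool" where
  "positive_discrete_rep \<pi> \<longleftrightarrow>
     separable_hilbert TYPE('h) \<and> unitary_rep \<pi> \<and> irreducible_rep \<pi> \<and>
     (\<forall>v\<in>smooth_vectors \<pi>. op_I \<pi> v = v) \<and>
     (\<exists>e. lowest_weight_vector \<pi> e \<and> cyclic_vector \<pi> e)"


section \<open>The operators \<open>T(\<xi>)\<close>\<close>

definition op_D :: "(jacobi \<Rightarrow> 'h::complex_hilbert_space \<Rightarrow> 'h) \<Rightarrow> complex \<Rightarrow> 'h \<Rightarrow> 'h" where
  "op_D \<pi> \<alpha> = op_exp (smooth_vectors \<pi>) (\<lambda>v. \<alpha> *\<^sub>C op_ad \<pi> v - cnj \<alpha> *\<^sub>C op_a \<pi> v)"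

definition siegel_zeta :: "complex \<Rightarrow> complex" where
  "siegel_zeta w =
     (THE \<zeta>. w = (if \<zeta> = 0 then 0
                else \<zeta> / complex_of_real (cmod \<zeta>) * complex_of_real (tanh (cmod \<zeta>))))"

definition op_S :: "(jacobi \<Rightarrow> 'h::complex_hilbert_space \<Rightarrow> 'h) \<Rightarrow> complex \<Rightarrow> 'h \<Rightarrow> 'h" where
  "op_S \<pi> w = op_exp (smooth_vectors \<pi>)
     (\<lambda>v. siegel_zeta w *\<^sub>C op_Kp \<pi> v - cnj (siegel_zeta w) *\<^sub>C op_Km \<pi> v)"

definition op_T :: "(jacobi \<Rightarrow> 'h::complex_hilbert_space \<Rightarrow> 'h) \<Rightarrow> complex \<times> complex \<Rightarrow> 'h \<Rightarrow> 'h" where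
  "op_T \<pi> \<xi> = op_D \<pi> (fst \<xi>) \<circ> op_S \<pi> (snd \<xi>)"


section \<open>The equations of motion\<close>

text \<open>All functions below depend on \<open>\<tau> = t / \<hbar>\<close>, which ranges over an interval \<open>J\<close>; at an end
  point of \<open>J\<close> derivatives are one-sided.\<close>

definition xy_eqs ::
  "real set \<Rightarrow> (real \<Rightarrow> real) \<Rightarrow> (real \<Rightarrow> real) \<Rightarrow> (real \<Rightarrow> real) \<Rightarrow> (real \<Rightarrow> real) \<Rightarrow> (real \<Rightarrow> real)
   \<Rightarrow> (real \<Rightarrow> real) \<Rightarrow> (real \<Rightarrow> real) \<Rightarrow> real \<Rightarrow> bool" where
  "xy_eqs J e0 e1 e2 \<nu>1 \<nu>2 x y \<tau> \<longleftrightarrow>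
     (x has_real_derivative - e2 \<tau> * x \<tau> + (e0 \<tau> - e1 \<tau>) * y \<tau> - \<nu>2 \<tau>) (at \<tau> within J) \<and>
     (y has_real_derivative - (e0 \<tau> + e1 \<tau>) * x \<tau> + e2 \<tau> * y \<tau> - \<nu>1 \<tau>) (at \<tau> within J)"

definition uv_eqs ::
  "real set \<Rightarrow> (real \<Rightarrow> real) \<Rightarrow> (real \<Rightarrow> real) \<Rightarrow> (real \<Rightarrow> real)
   \<Rightarrow> (real \<Rightarrow> real) \<Rightarrow> (real \<Rightarrow> real) \<Rightarrow> real \<Rightarrow> bool" where
  "uv_eqs J e0 e1 e2 u v \<tau> \<longleftrightarrow>
     (u has_real_derivative
        2 * v \<tau> * (e1 \<tau> * u \<tau> + e0 \<tau>) - e2 \<tau> * (1 - (u \<tau>)\<^sup>2 + (v \<tau>)\<^sup>2)) (at \<tau> within J) \<and>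
     (v has_real_derivative
        2 * u \<tau> * (e2 \<tau> * v \<tau> - e0 \<tau>) - e1 \<tau> * (1 + (u \<tau>)\<^sup>2 - (v \<tau>)\<^sup>2)) (at \<tau> within J)"

definition phase_eq ::
  "real set \<Rightarrow> real \<Rightarrow> (real \<Rightarrow> real) \<Rightarrow> (real \<Rightarrow> real) \<Rightarrow> (real \<Rightarrow> real) \<Rightarrow> (real \<Rightarrow> real)
   \<Rightarrow> (real \<Rightarrow> real) \<Rightarrow> (real \<Rightarrow> real) \<Rightarrow> (real \<Rightarrow> real) \<Rightarrow> (real \<Rightarrow> real) \<Rightarrow> (real \<Rightarrow> real)
   \<Rightarrow> (real \<Rightarrow> real) \<Rightarrow> real \<Rightarrow> bool" where
  "phase_eq J k e0 e1 e2 \<nu>1 \<nu>2 x y u v \<phi> \<tau> \<longleftrightarrow>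
     (\<phi> has_real_derivative
        \<nu>1 \<tau> * x \<tau> - \<nu>2 \<tau> * y \<tau> + 2 * k * (e0 \<tau> + e1 \<tau> * u \<tau> - e2 \<tau> * v \<tau>)) (at \<tau> within J)"

end

theory Submission
  imports Defs
begin

text \<open>With \<open>g(\<tau>) = ((\<alpha>, 0), M(w))\<close> and \<open>M(w) = (1 - |w|\<^sup>2)\<^sup>-\<^sup>1\<^sup>/\<^sup>2 (1, w; cnj w, 1)\<close> one has
  \<open>T(\<xi>) = \<pi>(g)\<close>, so that everything takes place on the group. If \<open>Z\<close> is the Lie algebra element
  with \<open>H\<^sub>0 = i d\<pi>(Z)\<close>, the equations of motion say that \<open>Z g\<close> and \<open>g'\<close> differ by \<open>g Y\<close>,
  where \<open>Y\<close> is a combination of the central element and of the rotation generator. Since \<open>d\<pi>(Y)\<close>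
  acts on \<open>\<Phi>\<close> as a scalar, this difference is exactly compensated by the phase \<open>\<phi>\<close>.\<close>

section \<open>Unitary operators and groups\<close>

text \<open>The operators \<open>op_D\<close> and \<open>op_S\<close> are chosen by a
  \<open>THE\<close> over unitary groups prescribed only infinitesimally, on smooth vectors.
  Identifying them with values of \<open>\<pi>\<close> therefore needs a uniqueness statement, which
  rests on two facts: smooth vectors are invariant under \<open>\<pi>\<close>, and they are dense
  because a cyclic smooth vector exists. Smoothness is extrinsic: an orbit map is locally the
  restriction of a smooth map on the surrounding vector space. Velocities and translated Lie algebra
  elements are vectors of that one space, and the differential of an orbit map is a linear map on
  it, so the relation between \<open>Z g\<close>, \<open>g'\<close> and \<open>g Y\<close> can be
  checked entry by entry. Linearity also handles sums in the Lie algebra, so that only Heisenberg,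
  rotation and boost subgroups have to be known explicitly. The correction \<open>Y\<close> arises
  because \<open>(\<alpha>, w)\<close> determines \<open>g\<close> only up to the centre and the
  rotations. The flow of \<open>Z\<close> moves \<open>(\<alpha>, w)\<close> as prescribed but
  leaves the family of elements \<open>((\<alpha>, 0), M(w))\<close>; \<open>Y\<close> measures by
  how much.\<close>

lemma scaleC_one: "(1::complex) *\<^sub>C (x::'h::complex_hilbert_space) = x"
  using scaleC_of_real[of 1 x] by simp

lemma scaleC_scaleR_right: "c *\<^sub>C (r *\<^sub>R (x::'h::complex_hilbert_space)) = r *\<^sub>R (c *\<^sub>C x)"
  by (metis scaleC_of_real scaleC_scaleC mult.commute)

lemma scaleC_scaleR_left: "(r *\<^sub>R c) *\<^sub>C (x::'h::complex_hilbert_space) = r *\<^sub>R (c *\<^sub>C x)"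
  by (metis scaleC_of_real scaleC_scaleC scaleR_conv_of_real)

lemma norm_eq_cinner: "(norm (x::'h::complex_hilbert_space))\<^sup>2 = Re (cinner x x)"
  by (simp add: Re_cinner dot_square_norm)

lemma norm_scaleC: "norm (c *\<^sub>C (x::'h::complex_hilbert_space)) = cmod c * norm x"
proof -
  have "cinner (c *\<^sub>C x) (c *\<^sub>C x) = c * cnj c * cinner x x"
    by (metis cinner_commute cinner_scaleC_right complex_cnj_mult mult.assoc)
  then have "(norm (c *\<^sub>C x))\<^sup>2 = (cmod c * norm x)\<^sup>2"
    by (simp add: norm_eq_cinner power_mult_distrib complex_mult_cnj flip: cmod_power2 of_real_mult of_real_power)
  then show ?thesis
    by (simp add: power2_eq_iff_nonneg)
qed

lemma bounded_bilinear_scaleC: "bounded_bilinear (scaleC :: complex \<Rightarrow> 'h::complex_hilbert_space \<Rightarrow> 'h)"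
  by standard (auto simp: scaleC_add_left scaleC_add_right scaleC_scaleR_left scaleC_scaleR_right
      norm_scaleC intro!: exI[of _ 1])

interpretation scaleC: bounded_bilinear "scaleC :: complex \<Rightarrow> 'h::complex_hilbert_space \<Rightarrow> 'h"
  by (rule bounded_bilinear_scaleC)

lemma unitary_op_norm:
  assumes "unitary_op U" shows "norm (U x) = norm x"
proof -
  have "(norm (U x))\<^sup>2 = (norm x)\<^sup>2"
    using assms by (simp add: norm_eq_cinner unitary_op_def)
  then show ?thesis by simp
qed

lemma unitary_op_bounded_linear:
  assumes "unitary_op U" shows "bounded_linear U"
proof (rule bounded_linear_intro)
  show "U (r *\<^sub>R x) = r *\<^sub>R U x" for r x
    using assms by (metis unitary_op_def scaleC_of_real)
  show "norm (U x) \<le> norm x * 1" for x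
    using unitary_op_norm[OF assms] by simp
qed (use assms in \<open>simp add: unitary_op_def\<close>)

text \<open>The group law makes \<open>U 0\<close> idempotent. It therefore kills
  \<open>U 0 v - v\<close>, and a norm-preserving map kills only zero.\<close>

lemma unitary_group_zero:
  assumes "unitary_group U" shows "U 0 v = v"
proof -
  have "U 0 (U 0 v) = U 0 v"
    using assms unfolding unitary_group_def by (metis add_0 comp_apply)
  then have "U 0 (U 0 v - v) = 0"
    using unitary_op_bounded_linear[of "U 0"] assms
    by (simp add: unitary_group_def linear_simps bounded_linear.linear)
  then show ?thesis
    using assms unitary_op_norm[of "U 0"] by (metis unitary_group_def norm_eq_zero eq_iff_diff_eq_0)
qed

text \<open>The increments of \<open>V(-t) U(t) v\<close> have the norm of \<open>U(s) w - V(s) w\<close> with \<open>w = U(t) v\<close>,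
  so its derivative vanishes.\<close>

lemma unitary_group_unique:
  fixes U V :: "real \<Rightarrow> 'h::complex_hilbert_space \<Rightarrow> 'h"
  assumes U: "unitary_group U" and V: "unitary_group V"
    and dU: "\<And>v. v \<in> D \<Longrightarrow> ((\<lambda>t. U t v) has_vector_derivative A v) (at 0)"
    and dV: "\<And>v. v \<in> D \<Longrightarrow> ((\<lambda>t. V t v) has_vector_derivative A v) (at 0)"
    and inv: "\<And>t v. v \<in> D \<Longrightarrow> U t v \<in> D" and v: "v \<in> D"
  shows "V t v = U t v"
proof -
  note blV = unitary_op_bounded_linear[OF V[unfolded unitary_group_def, THEN conjunct1, rule_format]]
  have Vadd: "V (s + t) x = V s (V t x)" for s t x
    using V by (simp add: unitary_group_def)
  have Uadd: "U (s + t) x = U s (U t x)" for s t x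
    using U by (simp add: unitary_group_def)
  define h where "h t = V (-t) (U t v)" for t
  have "(h has_derivative (\<lambda>_. 0)) (at t)" for t
  proof -
    let ?w = "U t v"
    have w: "?w \<in> D" by (rule inv[OF v])
    have "((\<lambda>s. U s ?w - V s ?w) has_derivative (\<lambda>_. 0)) (at 0)"
      using has_vector_derivative_diff[OF dU[OF w] dV[OF w]]
      by (simp add: has_vector_derivative_def)
    then have "((\<lambda>s. norm (U s ?w - V s ?w) / \<bar>s\<bar>) \<longlongrightarrow> 0) (at 0)"
      by (simp add: has_derivative_iff_norm unitary_group_zero[OF U] unitary_group_zero[OF V])
    moreover have "norm (h (t + s) - h t) = norm (U s ?w - V s ?w)" for s
    proof -
      have "h (t + s) - h t = V (- t - s) (U s ?w) - V (- t - s) (V s ?w)"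
      proof -
        have "h (t + s) = V (- (t + s)) (U (s + t) v)"
          by (simp add: h_def add.commute)
        then show ?thesis
          using Vadd[of "- t - s" s ?w] by (simp add: h_def Uadd)
      qed
      also have "\<dots> = V (- t - s) (U s ?w - V s ?w)"
        by (simp add: bounded_linear.linear[OF blV] linear_diff)
      finally show ?thesis
        using V by (simp add: unitary_op_norm unitary_group_def)
    qed
    ultimately have "((\<lambda>y. norm (h y - h t) / norm (y - t)) \<longlongrightarrow> 0) (at t)"
      by (intro LIM_offset_zero_cancel[of _ t]) simp
    then show ?thesis
      by (simp add: has_derivative_iff_norm)
  qed
  then have "h t = h 0"
    by (intro has_derivative_zero_unique[of UNIV h]) auto
  then have "V t (h t) = V t v"
    by (simp add: h_def unitary_group_zero[OF U] unitary_group_zero[OF V])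
  then show ?thesis
    by (simp add: h_def flip: Vadd) (simp add: unitary_group_zero[OF V])
qed


section \<open>Composition of smooth maps\<close>

text \<open>Product and chain rules leave undifferentiated factors next to differentiated ones; this
  brings both to the same order in the inductions below.\<close>

lemma higher_differentiable_on_mono:
  "higher_differentiable_on S f (Suc n) \<Longrightarrow> higher_differentiable_on S f n"
proof (induction n arbitrary: f)
  case 0
  then have "f differentiable (at x)" if "x \<in> S" for x
    using that by simp
  then show ?case
    by (simp add: differentiable_imp_continuous_on differentiable_on_def differentiable_at_withinI)
next
  case (Suc n)
  have "higher_differentiable_on S (\<lambda>x. frechet_derivative f (at x) v) n" for v
    by (rule Suc.IH) (use Suc.prems in simp)
  then show ?case using Suc.prems by simp
qed

text \<open>\<open>frechet_derivative\<close> is a choice from the predicate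
  \<open>has_derivative\<close>. Maps that agree near \<open>x\<close> have the same predicate,
  hence the same chosen map, whether or not a derivative exists.\<close>

lemma frechet_derivative_transform:
  assumes "open S" "x \<in> S" "\<And>y. y \<in> S \<Longrightarrow> f y = g y"
  shows "f differentiable (at x) \<longleftrightarrow> g differentiable (at x)"
    and "frechet_derivative f (at x) = frechet_derivative g (at x)"
proof -
  have "(f has_derivative D) (at x) \<longleftrightarrow> (g has_derivative D) (at x)" for D
    using assms by (metis has_derivative_transform_within_open)
  then show "f differentiable (at x) \<longleftrightarrow> g differentiable (at x)"
    and "frechet_derivative f (at x) = frechet_derivative g (at x)"
    by (simp_all add: differentiable_def frechet_derivative_def)
qed

lemma higher_differentiable_on_transform:
  assumes "open S" "\<And>x. x \<in> S \<Longrightarrow> f x = g x" "higher_differentiable_on S f n"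
  shows "higher_differentiable_on S g n"
  using assms(2,3)
proof (induction n arbitrary: f g)
  case 0
  then show ?case using continuous_on_cong by fastforce
next
  case (Suc n)
  note * = frechet_derivative_transform[OF \<open>open S\<close>, of _ f g, OF _ Suc.prems(1)]
  have "higher_differentiable_on S (\<lambda>x. frechet_derivative g (at x) v) n" for v
    by (rule Suc.IH[of "\<lambda>x. frechet_derivative f (at x) v"]) (use Suc.prems(2) *(2) in auto)
  moreover have "g differentiable (at x)" if "x \<in> S" for x
    using *(1) that Suc.prems(2) by simp
  ultimately show ?case by simp
qed

text \<open>Replaces the chosen \<open>frechet_derivative\<close> in the recursion by an explicit
  candidate \<open>D\<close>. The candidate is known only on \<open>S\<close>; openness makes values
  elsewhere irrelevant to the derivatives.\<close>

lemma higher_differentiable_on_SucI: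
  assumes "open S" and der: "\<And>x. x \<in> S \<Longrightarrow> (f has_derivative D x) (at x)"
    and "\<And>v. higher_differentiable_on S (\<lambda>x. D x v) n"
  shows "higher_differentiable_on S f (Suc n)"
proof -
  have "frechet_derivative f (at x) = D x" if "x \<in> S" for x
    using frechet_derivative_at[OF der[OF that]] by simp
  then have "higher_differentiable_on S (\<lambda>x. frechet_derivative f (at x) v) n" for v
    by (intro higher_differentiable_on_transform[OF \<open>open S\<close> _ assms(3)[of v]]) simp
  then show ?thesis
    using der by (auto simp: differentiable_def)
qed

lemma higher_differentiable_on_derivative:
  assumes "higher_differentiable_on S f (Suc n)" "x \<in> S"
  shows "(f has_derivative frechet_derivative f (at x)) (at x)"
  using assms by (simp flip: frechet_derivative_works)

lemma higher_differentiable_on_const: "open S \<Longrightarrow> higher_differentiable_on S (\<lambda>_. c) n"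
proof (induction n arbitrary: c)
  case (Suc n)
  then show ?case
    by (intro higher_differentiable_on_SucI[where D = "\<lambda>_ _. 0"]) auto
qed simp

lemma higher_differentiable_on_add:
  assumes "open S"
  shows "higher_differentiable_on S f n \<Longrightarrow> higher_differentiable_on S g n
    \<Longrightarrow> higher_differentiable_on S (\<lambda>x. f x + g x) n"
proof (induction n arbitrary: f g)
  case 0
  then show ?case by (simp add: continuous_on_add)
next
  case (Suc n)
  show ?case
  proof (rule higher_differentiable_on_SucI[OF \<open>open S\<close>])
    show "((\<lambda>x. f x + g x) has_derivative
        (\<lambda>v. frechet_derivative f (at x) v + frechet_derivative g (at x) v)) (at x)" if "x \<in> S" for x
      by (intro has_derivative_add higher_differentiable_on_derivative[OF Suc.prems(1) that]
          higher_differentiable_on_derivative[OF Suc.prems(2) that])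
    show "higher_differentiable_on S
        (\<lambda>x. frechet_derivative f (at x) v + frechet_derivative g (at x) v) n" for v
      by (rule Suc.IH) (use Suc.prems in auto)
  qed
qed

lemma higher_differentiable_on_sum:
  assumes "open S" "finite I" "\<And>i. i \<in> I \<Longrightarrow> higher_differentiable_on S (f i) n"
  shows "higher_differentiable_on S (\<lambda>x. \<Sum>i\<in>I. f i x) n"
  using assms(2,3)
  by (induction I)
    (auto intro!: higher_differentiable_on_add higher_differentiable_on_const \<open>open S\<close>)

lemma higher_differentiable_on_bounded_linear:
  assumes "bounded_linear L" "open S"
  shows "higher_differentiable_on S f n \<Longrightarrow> higher_differentiable_on S (\<lambda>x. L (f x)) n"
proof (induction n arbitrary: f)
  case 0
  then show ?case
    using bounded_linear.continuous_on[OF assms(1)] by simp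
next
  case (Suc n)
  show ?case
  proof (rule higher_differentiable_on_SucI[OF \<open>open S\<close>])
    show "((\<lambda>x. L (f x)) has_derivative (\<lambda>v. L (frechet_derivative f (at x) v))) (at x)"
      if "x \<in> S" for x
      by (rule bounded_linear.has_derivative[OF assms(1) higher_differentiable_on_derivative[OF Suc.prems that]])
    show "higher_differentiable_on S (\<lambda>x. L (frechet_derivative f (at x) v)) n" for v
      by (rule Suc.IH) (use Suc.prems in auto)
  qed
qed

lemma higher_differentiable_on_scaleR:
  assumes "open S"
  shows "higher_differentiable_on S f n \<Longrightarrow> higher_differentiable_on S g n
    \<Longrightarrow> higher_differentiable_on S (\<lambda>x. f x *\<^sub>R g x) n"
proof (induction n arbitrary: f g)
  case 0
  then show ?case by (simp add: continuous_on_scaleR)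
next
  case (Suc n)
  show ?case
  proof (rule higher_differentiable_on_SucI[OF \<open>open S\<close>])
    show "((\<lambda>x. f x *\<^sub>R g x) has_derivative
        (\<lambda>v. f x *\<^sub>R frechet_derivative g (at x) v + frechet_derivative f (at x) v *\<^sub>R g x)) (at x)"
      if "x \<in> S" for x
      by (intro has_derivative_scaleR higher_differentiable_on_derivative[OF Suc.prems(1) that]
          higher_differentiable_on_derivative[OF Suc.prems(2) that])
    show "higher_differentiable_on S
        (\<lambda>x. f x *\<^sub>R frechet_derivative g (at x) v + frechet_derivative f (at x) v *\<^sub>R g x) n" for v
      by (intro higher_differentiable_on_add[OF \<open>open S\<close>] Suc.IH)
        (use Suc.prems higher_differentiable_on_mono in auto)
  qed
qed

text \<open>The domain of \<open>f\<close> is taken finite-dimensional so that the derivative of the composition is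
  a finite sum of products with the directional derivatives of \<open>f\<close>, the only ones
  \<^const>\<open>higher_differentiable_on\<close> speaks about.\<close>

lemma higher_differentiable_on_compose:
  fixes f :: "'b::euclidean_space \<Rightarrow> 'c::real_normed_vector"
  assumes "open S" "open T" "p ` S \<subseteq> T"
  shows "higher_differentiable_on T f n \<Longrightarrow> higher_differentiable_on S p n
    \<Longrightarrow> higher_differentiable_on S (\<lambda>x. f (p x)) n"
proof (induction n arbitrary: f)
  case 0
  then show ?case
    using assms(3) continuous_on_compose2[of T f S p] by simp
next
  case (Suc n)
  let ?D = "\<lambda>x v. \<Sum>b\<in>Basis. (frechet_derivative p (at x) v \<bullet> b) *\<^sub>R frechet_derivative f (at (p x)) b"
  show ?case
  proof (rule higher_differentiable_on_SucI[OF \<open>open S\<close>])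
    fix x assume "x \<in> S"
    then have p: "(p has_derivative frechet_derivative p (at x)) (at x)"
      and f: "(f has_derivative frechet_derivative f (at (p x))) (at (p x))"
      using higher_differentiable_on_derivative[OF Suc.prems(2)]
        higher_differentiable_on_derivative[OF Suc.prems(1)] assms(3) by auto
    have lin: "linear (frechet_derivative f (at (p x)))"
      using f has_derivative_linear by blast
    have expand: "frechet_derivative f (at (p x)) v
        = (\<Sum>b\<in>Basis. (v \<bullet> b) *\<^sub>R frechet_derivative f (at (p x)) b)" for v
      using linear_sum[OF lin, of "\<lambda>b. (v \<bullet> b) *\<^sub>R b" Basis]
      by (simp add: euclidean_representation linear_scale[OF lin])
    show "((\<lambda>x. f (p x)) has_derivative ?D x) (at x)"
      by (rule has_derivative_eq_rhs[OF has_derivative_compose[OF p f] ext]) (rule expand)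
  next
    fix v
    have "higher_differentiable_on S (\<lambda>x. frechet_derivative f (at (p x)) b) n" for b
      using Suc.prems(1) by (intro Suc.IH higher_differentiable_on_mono[OF Suc.prems(2)]) simp
    moreover have "higher_differentiable_on S (\<lambda>x. frechet_derivative p (at x) v \<bullet> b) n" for b
      using Suc.prems by (intro higher_differentiable_on_bounded_linear[OF bounded_linear_inner_left \<open>open S\<close>]) auto
    ultimately show "higher_differentiable_on S (\<lambda>x. ?D x v) n"
      by (intro higher_differentiable_on_sum higher_differentiable_on_scaleR \<open>open S\<close>) auto
  qed
qed

text \<open>The first derivative is affine and the second constant. Proving order
  \<open>Suc n\<close> and descending spares a separate case for mere continuity. The group law with
  one factor fixed has this shape.\<close>

lemma higher_differentiable_on_quadratic:
  assumes "open S" "bounded_linear L" "bounded_bilinear B"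
  shows "higher_differentiable_on S (\<lambda>x. c + L x + B x x) n"
proof -
  have affine: "higher_differentiable_on S (\<lambda>x. c + L x) n" if "bounded_linear L" for c L n
  proof (cases n)
    case 0
    then show ?thesis
      using bounded_linear.continuous_on[OF that continuous_on_id] by (simp add: continuous_on_add)
  next
    case (Suc m)
    show ?thesis
      unfolding Suc
      by (rule higher_differentiable_on_SucI[where D = "\<lambda>_. L"])
        (auto intro!: derivative_eq_intros bounded_linear.has_derivative[OF that]
          higher_differentiable_on_const \<open>open S\<close>)
  qed
  interpret B: bounded_bilinear B by fact
  have "higher_differentiable_on S (\<lambda>x. c + L x + B x x) (Suc n)"
  proof (rule higher_differentiable_on_SucI[OF \<open>open S\<close>])
    show "((\<lambda>x. c + L x + B x x) has_derivative (\<lambda>v. L v + (B x v + B v x))) (at x)" for x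
      by (auto intro!: derivative_eq_intros bounded_linear.has_derivative[OF assms(2)] B.FDERIV)
    show "higher_differentiable_on S (\<lambda>x. L v + (B x v + B v x)) n" for v
      by (rule affine) (intro bounded_linear_add B.bounded_linear_left B.bounded_linear_right)
  qed
  then show ?thesis
    by (rule higher_differentiable_on_mono)
qed


section \<open>One-parameter subgroups of the Jacobi group\<close>

abbreviation jacobi_mult :: "jacobi \<Rightarrow> jacobi \<Rightarrow> jacobi"  (infixl "\<odot>" 70)
  where "x \<odot> y \<equiv> x \<otimes>\<^bsub>jacobi_group\<^esub> y"

lemma jacobi_mult_eq:
  "x \<odot> y = ((fst (fst x) + mat_act (snd x) (fst (fst y)),
     snd (fst x) + snd (fst y) + Im (fst (fst x) * cnj (mat_act (snd x) (fst (fst y))))),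
     snd x ** snd y)"
  by (simp add: jacobi_group_def heis_mult_def split: prod.splits)

section \<open>The differential of the group law on the surrounding vector space\<close>

lemma bounded_bilinear_mat_act: "bounded_bilinear mat_act"
  unfolding bilinear_conv_bounded_bilinear[symmetric] bilinear_def
  by (auto intro!: linearI simp: mat_act_def algebra_simps scaleR_conv_of_real[where 'a = complex])

lemma bounded_bilinear_mat2_mult: "bounded_bilinear ((**) :: complex^2^2 \<Rightarrow> complex^2^2 \<Rightarrow> complex^2^2)"
  unfolding bilinear_conv_bounded_bilinear[symmetric] bilinear_def
  by (auto intro!: linearI simp: mat2_eq_iff matrix_matrix_mult_def sum_2 algebra_simps scaleR_conv_of_real[where 'a = complex])

lemma bounded_bilinear_Im_mult_cnj: "bounded_bilinear (\<lambda>x y. Im (x * cnj y))"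
  unfolding bilinear_conv_bounded_bilinear[symmetric] bilinear_def
  by (auto intro!: linearI simp: algebra_simps)

text \<open>The differential of the group law at \<open>(x, y)\<close> in direction
  \<open>(x', y')\<close>. With \<open>x' = 0\<close> it is the differential of left translation by
  \<open>x\<close>, with \<open>y' = 0\<close> that of right translation by \<open>y\<close>; taking
  the other point to be the identity gives the translates \<open>g Y\<close> and \<open>Z g\<close>
  of Lie algebra elements.\<close>

definition jacobi_mult_deriv :: "jacobi \<Rightarrow> jacobi \<Rightarrow> jacobi \<Rightarrow> jacobi \<Rightarrow> jacobi" where
  "jacobi_mult_deriv x x' y y' =
    (let b = mat_act (snd x) (fst (fst y));
         b' = mat_act (snd x) (fst (fst y')) + mat_act (snd x') (fst (fst y))
     in ((fst (fst x') + b',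
          snd (fst x') + snd (fst y') + (Im (fst (fst x) * cnj b') + Im (fst (fst x') * cnj b))),
         snd x ** snd y' + snd x' ** snd y))"

lemma jacobi_mult_has_vector_derivative:
  assumes x: "(x has_vector_derivative x') (at t within T)" and y: "(y has_vector_derivative y') (at t within T)"
  shows "((\<lambda>t. x t \<odot> y t) has_vector_derivative jacobi_mult_deriv (x t) x' (y t) y') (at t within T)"
proof -
  have proj: "((\<lambda>t. fst (fst (z t))) has_vector_derivative fst (fst z')) (at t within T)"
    "((\<lambda>t. snd (fst (z t))) has_vector_derivative snd (fst z')) (at t within T)"
    "((\<lambda>t. snd (z t)) has_vector_derivative snd z') (at t within T)"
    if "(z has_vector_derivative z') (at t within T)" for z :: "real \<Rightarrow> jacobi" and z'
    using that by (auto simp: has_vector_derivative_def intro!: derivative_eq_intros)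
  note b = bounded_bilinear.has_vector_derivative[OF bounded_bilinear_mat_act proj(3)[OF x] proj(1)[OF y]]
  show ?thesis
    unfolding jacobi_mult_eq jacobi_mult_deriv_def Let_def
    by (intro has_vector_derivative_Pair has_vector_derivative_add proj x y b
        bounded_bilinear.has_vector_derivative[OF bounded_bilinear_Im_mult_cnj]
        bounded_bilinear.has_vector_derivative[OF bounded_bilinear_mat2_mult])
qed

lemma jacobi_mult_deriv_zero [simp]: "jacobi_mult_deriv x 0 y 0 = 0"
  by (simp add: jacobi_mult_deriv_def Let_def mat_act_def mat2_eq_iff prod_eq_iff matrix_matrix_mult_def)

lemma jacobi_one: "\<one>\<^bsub>jacobi_group\<^esub> = ((0, 0), mat 1)"
  by (simp add: jacobi_group_def)

lemma jacobi_mult_deriv_one: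
  "jacobi_mult_deriv \<one>\<^bsub>jacobi_group\<^esub> x' \<one>\<^bsub>jacobi_group\<^esub> y' = x' + y'"
  by (simp add: jacobi_mult_deriv_def jacobi_one Let_def mat_act_def prod_eq_iff)
    (simp add: mat_def)

interpretation jacobi: group jacobi_group by (rule group_jacobi_group)

text \<open>The predicate under the \<open>THE\<close> of \<open>exp_curve\<close>, named so that it
  can be folded back there.\<close>

definition one_param_subgroup :: "(real \<Rightarrow> jacobi) \<Rightarrow> jacobi \<Rightarrow> bool" where
  "one_param_subgroup \<gamma> X \<longleftrightarrow> (\<forall>t. \<gamma> t \<in> carrier jacobi_group) \<and>
     (\<forall>s t. \<gamma> (s + t) = \<gamma> s \<odot> \<gamma> t) \<and> (\<gamma> has_vector_derivative X) (at 0)"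

lemma one_param_subgroup_zero:
  assumes "one_param_subgroup \<gamma> X" shows "\<gamma> 0 = \<one>\<^bsub>jacobi_group\<^esub>"
proof -
  have "\<gamma> 0 \<in> carrier jacobi_group" "\<gamma> 0 \<odot> \<gamma> 0 = \<gamma> 0"
    using assms unfolding one_param_subgroup_def by (metis, metis add_0)
  then show ?thesis by simp
qed

lemma has_vector_derivative_compose_affine:
  fixes a b t :: real
  assumes "(g has_vector_derivative g') (at (a * t + b))"
  shows "((\<lambda>s. g (a * s + b)) has_vector_derivative a *\<^sub>R g') (at t)"
proof -
  have "((\<lambda>s. a * s + b) has_vector_derivative a) (at t)"
    by (auto intro!: derivative_eq_intros)
  from vector_diff_chain_at[OF this assms] show ?thesis
    by (simp add: o_def)
qed

text \<open>Near \<open>t\<close> the curve is the fixed element \<open>\<gamma> t\<close> times the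
  curve near 0. This supplies continuity away from 0, which strong continuity of the associated
  unitary group requires.\<close>

lemma one_param_subgroup_shift:
  assumes "one_param_subgroup \<gamma> X"
  shows "(\<gamma> has_vector_derivative jacobi_mult_deriv (\<gamma> t) 0 (\<gamma> 0) X) (at t)"
proof -
  have "((\<lambda>s. \<gamma> (s - t)) has_vector_derivative X) (at t)"
    using has_vector_derivative_compose_affine[of \<gamma> X 1 t "- t"] assms
    by (simp add: one_param_subgroup_def)
  note jacobi_mult_has_vector_derivative[OF has_vector_derivative_const[of "\<gamma> t"] this]
  moreover have "(\<lambda>s. \<gamma> t \<odot> \<gamma> (s - t)) = \<gamma>"
  proof
    fix s
    have "\<gamma> (t + (s - t)) = \<gamma> t \<odot> \<gamma> (s - t)"
      using assms unfolding one_param_subgroup_def by blast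
    then show "\<gamma> t \<odot> \<gamma> (s - t) = \<gamma> s" by simp
  qed
  ultimately have "(\<gamma> has_vector_derivative jacobi_mult_deriv (\<gamma> t) 0 (\<gamma> (t - t)) X) (at t)"
    by (simp only:)
  then show ?thesis by simp
qed

text \<open>The product \<open>\<gamma> (-t) \<odot> \<eta> t\<close> is constant. Around any
  \<open>t\<close> it is the same product near 0, flanked by two fixed group elements, and at 0 the
  velocities \<open>- X\<close> and \<open>X\<close> cancel.\<close>

lemma one_param_subgroup_unique:
  assumes \<gamma>: "one_param_subgroup \<gamma> X" and \<eta>: "one_param_subgroup \<eta> X"
  shows "\<gamma> t = \<eta> t"
proof -
  have car [simp]: "\<gamma> t \<in> carrier jacobi_group" "\<eta> t \<in> carrier jacobi_group" for t
    using \<gamma> \<eta> by (simp_all add: one_param_subgroup_def)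
  have hom: "\<gamma> (s + t) = \<gamma> s \<odot> \<gamma> t" "\<eta> (s + t) = \<eta> s \<odot> \<eta> t" for s t
    using \<gamma> \<eta> by (simp_all add: one_param_subgroup_def)
  have zero [simp]: "\<gamma> 0 = \<one>\<^bsub>jacobi_group\<^esub>" "\<eta> 0 = \<one>\<^bsub>jacobi_group\<^esub>"
    using \<gamma> \<eta> one_param_subgroup_zero by blast+
  define h where "h t = \<gamma> (-t) \<odot> \<eta> t" for t
  have "(h has_vector_derivative 0) (at t)" for t
  proof -
    have "((\<lambda>s. \<gamma> (- s)) has_vector_derivative - X) (at 0)"
      using has_vector_derivative_compose_affine[of \<gamma> X "-1" 0 0] \<gamma>
      by (simp add: one_param_subgroup_def)
    moreover have "(\<eta> has_vector_derivative X) (at 0)"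
      using \<eta> by (simp add: one_param_subgroup_def)
    ultimately have "((\<lambda>s. \<gamma> (- s) \<odot> \<eta> s) has_vector_derivative 0) (at 0)"
      using jacobi_mult_has_vector_derivative[of "\<lambda>s. \<gamma> (- s)" "- X" 0 UNIV \<eta> X]
      by (simp add: jacobi_mult_deriv_one)
    then have "((\<lambda>s. \<gamma> (- (s - t)) \<odot> \<eta> (s - t)) has_vector_derivative 0) (at t)"
      using has_vector_derivative_compose_affine[of "\<lambda>s. \<gamma> (- s) \<odot> \<eta> s" 0 1 t "- t"] by simp
    note jacobi_mult_has_vector_derivative[OF jacobi_mult_has_vector_derivative[OF
          has_vector_derivative_const[of "\<gamma> (- t)"] this] has_vector_derivative_const[of "\<eta> t"]]
    moreover have "(\<lambda>s. (\<gamma> (- t) \<odot> (\<gamma> (- (s - t)) \<odot> \<eta> (s - t))) \<odot> \<eta> t) = h"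
    proof
      fix s
      have "h s = (\<gamma> (- t) \<odot> \<gamma> (- (s - t))) \<odot> (\<eta> (s - t) \<odot> \<eta> t)"
        unfolding hom[symmetric] h_def by simp
      then show "\<gamma> (- t) \<odot> (\<gamma> (- (s - t)) \<odot> \<eta> (s - t)) \<odot> \<eta> t = h s"
        by (simp only: jacobi.m_assoc car jacobi.m_closed)
    qed
    ultimately show ?thesis by (simp only: jacobi_mult_deriv_zero)
  qed
  then have "h t = h 0"
    by (intro has_derivative_zero_unique[of UNIV h]) (auto simp: has_vector_derivative_def)
  then have "\<gamma> t \<odot> h t = \<gamma> t" by (simp add: h_def)
  moreover have "\<gamma> t \<odot> \<gamma> (- t) = \<one>\<^bsub>jacobi_group\<^esub>"
    using hom(1)[of t "- t"] by simp
  ultimately show ?thesis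
    by (simp add: h_def flip: jacobi.m_assoc)
qed

lemma exp_curve_eq:
  assumes "one_param_subgroup \<gamma> X" shows "exp_curve X = \<gamma>"
  unfolding exp_curve_def one_param_subgroup_def[symmetric]
  by (intro the_equality ext one_param_subgroup_unique[OF _ assms] assms)

section \<open>The Heisenberg, rotation and boost subgroups\<close>

definition heis_curve :: "real \<Rightarrow> complex \<Rightarrow> real \<Rightarrow> jacobi" where
  "heis_curve s \<alpha> t = ((t *\<^sub>R \<alpha>, t * s), mat 1)"

definition rot_curve :: "real \<Rightarrow> real \<Rightarrow> jacobi" where
  "rot_curve \<theta> t = (0, mat2 (cis (\<theta> * t)) 0 0 (cis (- (\<theta> * t))))"

text \<open>The exponential of \<open>t\<close> times the matrix with zero diagonal and off-diagonal
  entries \<open>y\<close> and \<open>cnj y\<close>, whose square is a multiple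
  \<open>(cmod y)\<^sup>2\<close> of the identity. The default \<open>sgn 0 = 0\<close> covers
  \<open>y = 0\<close>.\<close>

definition boost_curve :: "complex \<Rightarrow> real \<Rightarrow> jacobi" where
  "boost_curve y t = (0, mat2 (of_real (cosh (t * cmod y))) (sgn y * of_real (sinh (t * cmod y)))
     (cnj (sgn y) * of_real (sinh (t * cmod y))) (of_real (cosh (t * cmod y))))"

lemma has_vector_derivative_mat2:
  assumes "(a has_vector_derivative a') (at t within T)" "(b has_vector_derivative b') (at t within T)"
    "(c has_vector_derivative c') (at t within T)" "(d has_vector_derivative d') (at t within T)"
  shows "((\<lambda>t. mat2 (a t) (b t) (c t) (d t)) has_vector_derivative mat2 a' b' c' d') (at t within T)"
proof -
  have "bounded_linear (\<lambda>(a, b, c, d). mat2 a b c d)"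
    by (intro linear_conv_bounded_linear[THEN iffD1] linearI) (auto simp: mat2_eq_iff)
  from bounded_linear.has_vector_derivative[OF this
      has_vector_derivative_Pair[OF assms(1) has_vector_derivative_Pair[OF assms(2)
        has_vector_derivative_Pair[OF assms(3,4)]]]]
  show ?thesis by simp
qed

lemma mat1_eq_mat2: "mat 1 = mat2 1 0 0 1"
  by (simp add: mat2_eq_iff mat_def)

lemma SU11_I: "p * cnj p - q * cnj q = 1 \<Longrightarrow> mat2 p q (cnj q) (cnj p) \<in> SU11"
  unfolding SU11_eq by blast

lemma carrier_jacobi_iff: "g \<in> carrier jacobi_group \<longleftrightarrow> snd g \<in> SU11"
  by (cases g) (simp add: jacobi_group_def)

text \<open>The Heisenberg cocycle vanishes between real multiples of the same
  \<open>\<alpha>\<close>, so the subgroup is a straight line with constant velocity.\<close>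

lemma one_param_subgroup_heis: "one_param_subgroup (heis_curve s \<alpha>) (jacobi_elem s \<alpha> 0 0)"
  unfolding one_param_subgroup_def
proof (intro conjI allI)
  show "heis_curve s \<alpha> t \<in> carrier jacobi_group" for t
    using SU11_I[of 1 0] by (simp add: heis_curve_def carrier_jacobi_iff mat1_eq_mat2)
  show "heis_curve s \<alpha> (r + t) = heis_curve s \<alpha> r \<odot> heis_curve s \<alpha> t" for r t
    unfolding jacobi_mult_eq
    by (simp add: heis_curve_def mat_act_def mat1_eq_mat2 mat2_mult scaleR_conv_of_real algebra_simps)
  have "heis_curve s \<alpha> = (\<lambda>t. (0, mat 1) + t *\<^sub>R jacobi_elem s \<alpha> 0 0)"
    by (simp add: fun_eq_iff heis_curve_def jacobi_elem_def mat2_eq_iff)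
  moreover have "((\<lambda>t. (0, mat 1) + t *\<^sub>R jacobi_elem s \<alpha> 0 0) has_vector_derivative jacobi_elem s \<alpha> 0 0) (at 0)"
    by (auto intro!: derivative_eq_intros)
  ultimately show "(heis_curve s \<alpha> has_vector_derivative jacobi_elem s \<alpha> 0 0) (at 0)"
    by simp
qed

lemma one_param_subgroup_rot: "one_param_subgroup (rot_curve \<theta>) (jacobi_elem 0 0 \<theta> 0)"
  unfolding one_param_subgroup_def
proof (intro conjI allI)
  show "rot_curve \<theta> t \<in> carrier jacobi_group" for t
    using SU11_I[of "cis (\<theta> * t)" 0] by (simp add: rot_curve_def carrier_jacobi_iff cis_cnj cis_mult)
  show "rot_curve \<theta> (r + t) = rot_curve \<theta> r \<odot> rot_curve \<theta> t" for r t
    unfolding jacobi_mult_eq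
    by (simp add: rot_curve_def mat_act_def mat2_mult cis_mult prod_eq_iff algebra_simps)
  have "((\<lambda>t. cis (r * t)) has_vector_derivative \<i> * r) (at 0)" for r
    unfolding has_vector_derivative_complex_iff by (auto intro!: derivative_eq_intros)
  from this[of \<theta>] this[of "- \<theta>"]
  show "(rot_curve \<theta> has_vector_derivative jacobi_elem 0 0 \<theta> 0) (at 0)"
    unfolding rot_curve_def jacobi_elem_def
    by (intro has_vector_derivative_Pair has_vector_derivative_mat2)
      (auto intro!: derivative_eq_intros simp: zero_prod_def)
qed

lemma one_param_subgroup_boost: "one_param_subgroup (boost_curve y) (jacobi_elem 0 0 0 y)"
  unfolding one_param_subgroup_def
proof (intro conjI allI)
  have sgn: "sgn y * cnj (sgn y) = (if y = 0 then 0 else 1)"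
    by (simp add: norm_sgn flip: complex_norm_square)
  show "boost_curve y t \<in> carrier jacobi_group" for t
  proof -
    let ?q = "sgn y * complex_of_real (sinh (t * cmod y))"
    have "?q * cnj ?q = (sgn y * cnj (sgn y)) * of_real (sinh (t * cmod y) * sinh (t * cmod y))"
      by simp
    also have "\<dots> = of_real (sinh (t * cmod y) * sinh (t * cmod y))"
      by (simp add: sgn)
    finally have "complex_of_real (cosh (t * cmod y)) * cnj (of_real (cosh (t * cmod y))) - ?q * cnj ?q
        = of_real ((cosh (t * cmod y))\<^sup>2 - (sinh (t * cmod y))\<^sup>2)"
      by (simp add: power2_eq_square)
    also have "\<dots> = 1" by (simp add: hyperbolic_pythagoras)
    finally show ?thesis
      using SU11_I[of "of_real (cosh (t * cmod y))" ?q]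
      by (simp add: boost_curve_def carrier_jacobi_iff)
  qed
  show "boost_curve y (r + t) = boost_curve y r \<odot> boost_curve y t" for r t
  proof (cases "y = 0")
    case True
    then show ?thesis
      unfolding jacobi_mult_eq by (simp add: boost_curve_def mat_act_def mat2_mult prod_eq_iff)
  next
    case False
    with sgn have "sgn y * cnj (sgn y) = 1" "cnj (sgn y) * sgn y = 1"
      by (simp_all add: mult.commute)
    then have "sgn y * (cnj (sgn y) * z) = z" "cnj (sgn y) * (sgn y * z) = z" for z
      by (simp_all flip: mult.assoc)
    then show ?thesis
      unfolding jacobi_mult_eq
      by (simp add: boost_curve_def mat_act_def mat2_mult prod_eq_iff mat2_eq_iff
          cosh_add sinh_add algebra_simps)
  qed
  have "((\<lambda>t. complex_of_real (cosh (t * cmod y))) has_vector_derivative 0) (at 0)"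
    "((\<lambda>t. complex_of_real (sinh (t * cmod y))) has_vector_derivative cmod y) (at 0)"
    unfolding has_vector_derivative_complex_iff by (auto intro!: derivative_eq_intros)
  moreover have "sgn y * cmod y = y"
    by (cases "y = 0") (simp_all add: sgn_eq)
  moreover from this have "cnj (sgn y) * cmod y = cnj y"
    by (metis complex_cnj_complex_of_real complex_cnj_mult)
  ultimately show "(boost_curve y has_vector_derivative jacobi_elem 0 0 0 y) (at 0)"
    unfolding boost_curve_def jacobi_elem_def
    by (intro has_vector_derivative_Pair has_vector_derivative_mat2)
      (auto intro!: derivative_eq_intros simp: zero_prod_def)
qed


section \<open>Orbit maps of smooth vectors\<close>

text \<open>Right translation is a constant plus a linear map plus the Heisenberg cocycle. The
  cocycle is quadratic in \<open>h\<close>, which enters it both through its translation part and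
  through its matrix.\<close>

lemma higher_differentiable_on_jacobi_mult_left:
  assumes "open S" shows "higher_differentiable_on S (\<lambda>h. h \<odot> g) n"
proof -
  define L :: "jacobi \<Rightarrow> jacobi" where
    "L h = ((fst (fst h) + mat_act (snd h) (fst (fst g)), snd (fst h)), snd h ** snd g)" for h
  define B :: "jacobi \<Rightarrow> jacobi \<Rightarrow> jacobi" where
    "B h k = ((0, Im (fst (fst h) * cnj (mat_act (snd k) (fst (fst g))))), 0)" for h k
  interpret act: bounded_bilinear mat_act by (rule bounded_bilinear_mat_act)
  interpret mul: bounded_bilinear "(**) :: complex^2^2 \<Rightarrow> complex^2^2 \<Rightarrow> complex^2^2"
    by (rule bounded_bilinear_mat2_mult)
  have "bounded_linear L"
    unfolding linear_conv_bounded_linear[symmetric] L_def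
    by (intro linearI) (simp_all add: act.add_left act.scaleR_left mul.add_left mul.scaleR_left scaleR_add_right)
  moreover have "bounded_bilinear B"
    unfolding bilinear_conv_bounded_bilinear[symmetric] bilinear_def B_def
    by (auto intro!: linearI simp: act.add_left act.scaleR_left algebra_simps)
  moreover have "(\<lambda>h. h \<odot> g) = (\<lambda>h. ((0, snd (fst g)), 0) + L h + B h h)"
    by (simp add: fun_eq_iff jacobi_mult_eq L_def B_def)
  ultimately show ?thesis
    by (simp only: higher_differentiable_on_quadratic assms)
qed

context
  fixes \<pi> :: "jacobi \<Rightarrow> 'h::complex_hilbert_space \<Rightarrow> 'h"
  assumes rep: "unitary_rep \<pi>"
begin

lemma rep_unitary: "g \<in> carrier jacobi_group \<Longrightarrow> unitary_op (\<pi> g)"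
  using rep by (simp add: unitary_rep_def)

lemma rep_mult:
  "g \<in> carrier jacobi_group \<Longrightarrow> h \<in> carrier jacobi_group \<Longrightarrow> \<pi> (g \<odot> h) v = \<pi> g (\<pi> h v)"
  using rep by (simp add: unitary_rep_def)

lemma rep_scaleC: "g \<in> carrier jacobi_group \<Longrightarrow> \<pi> g (c *\<^sub>C v) = c *\<^sub>C \<pi> g v"
  using rep_unitary by (simp add: unitary_op_def)

text \<open>The orbit map of \<open>\<pi> g v\<close> is the orbit map of \<open>v\<close> after
  right translation by \<open>g\<close>, so local smooth extensions are pulled back along that
  translation, which is smooth on the whole vector space.\<close>

lemma smooth_vectors_rep:
  assumes v: "v \<in> smooth_vectors \<pi>" and g: "g \<in> carrier jacobi_group"
  shows "\<pi> g v \<in> smooth_vectors \<pi>"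
  unfolding smooth_vectors_def mem_Collect_eq
proof
  fix k assume k: "k \<in> carrier jacobi_group"
  then have "k \<odot> g \<in> carrier jacobi_group" using g by simp
  then obtain S F where SF: "k \<odot> g \<in> S" "smooth_on_open S F"
    and F: "\<And>h. h \<in> S \<inter> carrier jacobi_group \<Longrightarrow> \<pi> h v = F h"
    using v unfolding smooth_vectors_def by blast
  let ?S = "(\<lambda>h. h \<odot> g) -` S"
  have "open S" and hd: "higher_differentiable_on S F n" for n
    using SF(2) by (auto simp: smooth_on_open_def)
  have "continuous_on UNIV (\<lambda>h. h \<odot> g)"
    using higher_differentiable_on_jacobi_mult_left[of UNIV g 0] by simp
  then have "open ?S"
    using \<open>open S\<close> open_vimage by blast
  then have "smooth_on_open ?S (\<lambda>h. F (h \<odot> g))"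
    unfolding smooth_on_open_def
    by (intro conjI allI higher_differentiable_on_compose[OF _ \<open>open S\<close> _ hd]
      higher_differentiable_on_jacobi_mult_left) auto
  moreover have "\<pi> h (\<pi> g v) = F (h \<odot> g)" if "h \<in> ?S \<inter> carrier jacobi_group" for h
    using that g F[of "h \<odot> g"] rep_mult[of h g v] by simp
  ultimately show "\<exists>S F. k \<in> S \<and> smooth_on_open S F \<and>
      (\<forall>h\<in>S \<inter> carrier jacobi_group. \<pi> h (\<pi> g v) = F h)"
    using SF(1) by (intro exI[of _ ?S] exI[of _ "\<lambda>h. F (h \<odot> g)"]) simp
qed

lemma smooth_vectors_scaleC:
  assumes v: "v \<in> smooth_vectors \<pi>"
  shows "c *\<^sub>C v \<in> smooth_vectors \<pi>"
  unfolding smooth_vectors_def mem_Collect_eq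
proof
  fix g assume g: "g \<in> carrier jacobi_group"
  then obtain S F where SF: "g \<in> S" "smooth_on_open S F"
    and F: "\<forall>h\<in>S \<inter> carrier jacobi_group. \<pi> h v = F h"
    using v unfolding smooth_vectors_def by blast
  have "smooth_on_open S (\<lambda>h. c *\<^sub>C F h)"
    using SF(2) unfolding smooth_on_open_def
    by (auto intro: higher_differentiable_on_bounded_linear[OF bounded_bilinear.bounded_linear_right[OF bounded_bilinear_scaleC]])
  then show "\<exists>S F. g \<in> S \<and> smooth_on_open S F \<and>
      (\<forall>h\<in>S \<inter> carrier jacobi_group. \<pi> h (c *\<^sub>C v) = F h)"
    using SF(1) F by (intro exI[of _ S] exI[of _ "\<lambda>h. c *\<^sub>C F h"]) (simp add: rep_scaleC)
qed

end

text \<open>A differential at \<open>g\<close> of the orbit map of \<open>v\<close>, tested on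
  curves in the group. \<open>L\<close> acts on the whole vector space since it comes from a smooth
  extension; only its values on velocities of group curves matter. The set \<open>T\<close> is
  arbitrary in order to allow one-sided derivatives at end points of an interval.\<close>

definition orbit_derivative ::
  "(jacobi \<Rightarrow> 'h::complex_hilbert_space \<Rightarrow> 'h) \<Rightarrow> jacobi \<Rightarrow> 'h \<Rightarrow> (jacobi \<Rightarrow> 'h) \<Rightarrow> bool" where
  "orbit_derivative \<pi> g v L \<longleftrightarrow> linear L \<and>
     (\<forall>\<gamma> T t X. (\<forall>s\<in>T. \<gamma> s \<in> carrier jacobi_group) \<longrightarrow> t \<in> T \<longrightarrow> \<gamma> t = g \<longrightarrow>
        (\<gamma> has_vector_derivative X) (at t within T) \<longrightarrow>
        ((\<lambda>s. \<pi> (\<gamma> s) v) has_vector_derivative L X) (at t within T))"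

lemma orbit_derivative_exists:
  assumes v: "v \<in> smooth_vectors \<pi>" and g: "g \<in> carrier jacobi_group"
  obtains L where "orbit_derivative \<pi> g v L"
proof -
  obtain S F where SF: "g \<in> S" "smooth_on_open S F"
    and F: "\<And>h. h \<in> S \<inter> carrier jacobi_group \<Longrightarrow> \<pi> h v = F h"
    using v g unfolding smooth_vectors_def by blast
  have "open S" "higher_differentiable_on S F (Suc 0)"
    using SF(2) unfolding smooth_on_open_def by blast+
  then obtain L where L: "(F has_derivative L) (at g)"
    using higher_differentiable_on_derivative SF(1) by blast
  have "((\<lambda>s. \<pi> (\<gamma> s) v) has_vector_derivative L X) (at t within T)"
    if \<gamma>: "\<forall>s\<in>T. \<gamma> s \<in> carrier jacobi_group" and t: "t \<in> T" "\<gamma> t = g"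
      and X: "(\<gamma> has_vector_derivative X) (at t within T)" for \<gamma> T t X
  proof -
    have dF: "((\<lambda>s. F (\<gamma> s)) has_vector_derivative L X) (at t within T)"
      using vector_derivative_diff_chain_within[OF X, of F L] L t
      by (simp add: o_def has_derivative_at_withinI)
    \<comment> \<open>The extension \<open>F\<close> agrees with the orbit map only on the part of
      the group inside \<open>S\<close>, so the curve has to be kept in \<open>S\<close> near
      \<open>t\<close> before the two derivatives can be exchanged.\<close>
    obtain d where d: "d > 0" "\<And>s. s \<in> T \<Longrightarrow> dist s t < d \<Longrightarrow> \<gamma> s \<in> S"
    proof -
      have "continuous (at t within T) \<gamma>"
        using X by (rule has_vector_derivative_continuous)
      then have "\<forall>\<^sub>F s in at t within T. \<gamma> s \<in> S"
        using \<open>open S\<close> SF(1) t unfolding continuous_within by (auto dest: topological_tendstoD)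
      then show ?thesis
        using that SF(1) t unfolding eventually_at by metis
    qed
    have eq: "F (\<gamma> s) = \<pi> (\<gamma> s) v" if "s \<in> T" "dist s t < d" for s
      using F[of "\<gamma> s"] d(2)[OF that] \<gamma> that(1) by simp
    show ?thesis
      by (rule has_vector_derivative_transform_within[OF dF d(1) t(1) eq])
  qed
  then show ?thesis
    using that[of L] has_derivative_linear[OF L] unfolding orbit_derivative_def by blast
qed

lemma orbit_derivativeD:
  assumes "orbit_derivative \<pi> g v L" "(\<gamma> has_vector_derivative X) (at t within T)"
    "\<And>s. s \<in> T \<Longrightarrow> \<gamma> s \<in> carrier jacobi_group" "t \<in> T" "\<gamma> t = g"
  shows "((\<lambda>s. \<pi> (\<gamma> s) v) has_vector_derivative L X) (at t within T)"
  using assms unfolding orbit_derivative_def by blast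

lemma one_param_subgroup_orbit:
  assumes L: "orbit_derivative \<pi> \<one>\<^bsub>jacobi_group\<^esub> v L" and \<gamma>: "one_param_subgroup \<gamma> X"
  shows "((\<lambda>t. \<pi> (\<gamma> t) v) has_vector_derivative L X) (at 0)"
  using orbit_derivativeD[OF L, of \<gamma> X 0 UNIV] one_param_subgroup_zero[OF \<gamma>] \<gamma>
  by (simp add: one_param_subgroup_def)

lemma dpi_eq:
  assumes L: "orbit_derivative \<pi> \<one>\<^bsub>jacobi_group\<^esub> v L" and \<gamma>: "one_param_subgroup \<gamma> X"
  shows "dpi \<pi> X v = L X"
  unfolding dpi_def exp_curve_eq[OF \<gamma>]
  by (rule vector_derivative_at[OF one_param_subgroup_orbit[OF L \<gamma>]])

lemma orbit_derivative_scaleC: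
  assumes "unitary_rep \<pi>" "orbit_derivative \<pi> g v L"
  shows "orbit_derivative \<pi> g (c *\<^sub>C v) (\<lambda>X. c *\<^sub>C L X)"
proof -
  have "linear L" using assms(2) by (simp add: orbit_derivative_def)
  then have "linear (\<lambda>X. c *\<^sub>C L X)"
    by (intro linearI) (simp_all only: linear_add linear_scale scaleC_add_right scaleC_scaleR_right)
  moreover have "((\<lambda>s. \<pi> (\<gamma> s) (c *\<^sub>C v)) has_vector_derivative c *\<^sub>C L X) (at t within T)"
    if \<gamma>: "\<forall>s\<in>T. \<gamma> s \<in> carrier jacobi_group" and t: "t \<in> T" "\<gamma> t = g"
      and X: "(\<gamma> has_vector_derivative X) (at t within T)" for \<gamma> T t X
  proof -
    have "((\<lambda>s. c *\<^sub>C \<pi> (\<gamma> s) v) has_vector_derivative c *\<^sub>C L X) (at t within T)"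
      using orbit_derivativeD[OF assms(2) X] \<gamma> t
      by (intro bounded_linear.has_vector_derivative[OF bounded_bilinear.bounded_linear_right[OF bounded_bilinear_scaleC]]) auto
    then show ?thesis
      using t(1) \<gamma> rep_scaleC[OF assms(1)]
      by (intro has_vector_derivative_transform[of t T "\<lambda>s. \<pi> (\<gamma> s) (c *\<^sub>C v)"]) auto
  qed
  ultimately show ?thesis unfolding orbit_derivative_def by blast
qed

text \<open>Both sides are the derivative at 0 of \<open>\<pi> (g \<odot> \<gamma> t) v\<close>: one
  computed with the bounded operator \<open>\<pi> g\<close> in front, the other from the curve
  \<open>g \<odot> \<gamma> t\<close> through \<open>g\<close>.\<close>

lemma orbit_derivative_left:
  assumes rep: "unitary_rep \<pi>" and g: "g \<in> carrier jacobi_group"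
    and L: "orbit_derivative \<pi> \<one>\<^bsub>jacobi_group\<^esub> v L" and L': "orbit_derivative \<pi> g v L'"
    and \<gamma>: "one_param_subgroup \<gamma> X"
  shows "\<pi> g (L X) = L' (jacobi_mult_deriv g 0 \<one>\<^bsub>jacobi_group\<^esub> X)"
proof -
  have car: "\<And>t. \<gamma> t \<in> carrier jacobi_group" and zero: "\<gamma> 0 = \<one>\<^bsub>jacobi_group\<^esub>"
    and der: "(\<gamma> has_vector_derivative X) (at 0)"
    using \<gamma> one_param_subgroup_zero[OF \<gamma>] by (simp_all add: one_param_subgroup_def)
  have "((\<lambda>t. \<pi> g (\<pi> (\<gamma> t) v)) has_vector_derivative \<pi> g (L X)) (at 0)"
    by (rule bounded_linear.has_vector_derivative[OF unitary_op_bounded_linear[OF rep_unitary[OF rep g]]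
          one_param_subgroup_orbit[OF L \<gamma>]])
  then have "((\<lambda>t. \<pi> (g \<odot> \<gamma> t) v) has_vector_derivative \<pi> g (L X)) (at 0)"
    by (simp add: rep_mult[OF rep g car])
  moreover have "((\<lambda>t. g \<odot> \<gamma> t) has_vector_derivative jacobi_mult_deriv g 0 \<one>\<^bsub>jacobi_group\<^esub> X) (at 0)"
    using jacobi_mult_has_vector_derivative[OF has_vector_derivative_const der] zero by metis
  then have "((\<lambda>t. \<pi> (g \<odot> \<gamma> t) v) has_vector_derivative
      L' (jacobi_mult_deriv g 0 \<one>\<^bsub>jacobi_group\<^esub> X)) (at 0)"
    by (rule orbit_derivativeD[OF L']) (use car g zero in auto)
  ultimately show ?thesis
    by (rule vector_derivative_unique_at)
qed

text \<open>The companion of the previous lemma for the curve \<open>\<gamma> t \<odot> g\<close>.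
  It turns the derived representation at the moved vector \<open>\<pi> g v\<close> into the
  differential at \<open>g\<close> of the orbit of \<open>v\<close>, so that both translations are
  compared under a single \<open>L'\<close>.\<close>

lemma orbit_derivative_right:
  assumes rep: "unitary_rep \<pi>" and g: "g \<in> carrier jacobi_group"
    and L: "orbit_derivative \<pi> \<one>\<^bsub>jacobi_group\<^esub> (\<pi> g v) L" and L': "orbit_derivative \<pi> g v L'"
    and \<gamma>: "one_param_subgroup \<gamma> X"
  shows "L X = L' (jacobi_mult_deriv \<one>\<^bsub>jacobi_group\<^esub> X g 0)"
proof -
  have car: "\<And>t. \<gamma> t \<in> carrier jacobi_group" and zero: "\<gamma> 0 = \<one>\<^bsub>jacobi_group\<^esub>"
    and der: "(\<gamma> has_vector_derivative X) (at 0)"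
    using \<gamma> one_param_subgroup_zero[OF \<gamma>] by (simp_all add: one_param_subgroup_def)
  have "((\<lambda>t. \<pi> (\<gamma> t \<odot> g) v) has_vector_derivative L X) (at 0)"
    using one_param_subgroup_orbit[OF L \<gamma>] by (simp add: rep_mult[OF rep car g])
  moreover have "((\<lambda>t. \<gamma> t \<odot> g) has_vector_derivative jacobi_mult_deriv \<one>\<^bsub>jacobi_group\<^esub> X g 0) (at 0)"
    using jacobi_mult_has_vector_derivative[OF der has_vector_derivative_const] zero by metis
  then have "((\<lambda>t. \<pi> (\<gamma> t \<odot> g) v) has_vector_derivative
      L' (jacobi_mult_deriv \<one>\<^bsub>jacobi_group\<^esub> X g 0)) (at 0)"
    by (rule orbit_derivativeD[OF L']) (use car g zero in auto)
  ultimately show ?thesis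
    by (rule vector_derivative_unique_at)
qed

section \<open>Generators as values of the differential at the identity\<close>

lemma jacobi_elem_eq_0: "jacobi_elem 0 0 0 0 = 0"
  by (simp add: jacobi_elem_def mat2_eq_iff prod_eq_iff)

lemma scaleR_conv_scaleC: "r *\<^sub>R (x::'h::complex_hilbert_space) = complex_of_real r *\<^sub>C x"
  by (simp add: scaleC_of_real)

text \<open>The two bracketed vectors are the shape taken by \<open>op_ad\<close> and
  \<open>op_a\<close>, and equally by \<open>op_Kp\<close> and \<open>op_Km\<close>, when
  \<open>p\<close> and \<open>q\<close> are the values of the differential at parameters 1 and
  \<open>\<i>\<close>. The skew combination recovers the real-linear value at parameter
  \<open>c\<close>.\<close>

lemma scaleC_real_combination:
  fixes p q :: "'h::complex_hilbert_space"
  shows "c *\<^sub>C ((1/2) *\<^sub>C p + (-\<i>/2) *\<^sub>C q) - cnj c *\<^sub>C ((-1/2) *\<^sub>C p + (-\<i>/2) *\<^sub>C q)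
    = Re c *\<^sub>R p + Im c *\<^sub>R q"
proof -
  have "complex_of_real (Re c) = c * (1/2) - cnj c * (-1/2)"
    "complex_of_real (Im c) = c * (-\<i>/2) - cnj c * (-\<i>/2)"
    by (simp_all add: complex_eq_iff)
  then show ?thesis
    by (simp only: scaleR_conv_scaleC scaleC.diff_left scaleC_add_right scaleC_scaleC add_diff_add)
qed

context
  fixes \<pi> :: "jacobi \<Rightarrow> 'h::complex_hilbert_space \<Rightarrow> 'h" and v L
  assumes L: "orbit_derivative \<pi> \<one>\<^bsub>jacobi_group\<^esub> v L"
begin

lemma orbit_derivative_linear: "linear L"
  using L by (simp add: orbit_derivative_def)

lemma dpi_elem:
  "dpi \<pi> (jacobi_elem s \<alpha> 0 0) v = L (jacobi_elem s \<alpha> 0 0)"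
  "dpi \<pi> (jacobi_elem 0 0 \<theta> 0) v = L (jacobi_elem 0 0 \<theta> 0)"
  "dpi \<pi> (jacobi_elem 0 0 0 y) v = L (jacobi_elem 0 0 0 y)"
  by (rule dpi_eq[OF L] one_param_subgroup_heis one_param_subgroup_rot one_param_subgroup_boost)+

lemma dpi_zero: "dpi \<pi> 0 v = 0"
  using dpi_elem(1)[of 0 0] linear_0[OF orbit_derivative_linear] by (simp add: jacobi_elem_eq_0)

text \<open>The complexified generators are pairs of real elements, whereas \<open>L\<close> is only
  real-linear. Splitting the parameter along 1 and \<open>\<i>\<close> undoes the pairing and
  returns the skew combination to a single real Lie algebra element.\<close>

lemma op_heis:
  "(\<i> * complex_of_real s) *\<^sub>C op_I \<pi> v + (\<alpha> *\<^sub>C op_ad \<pi> v - cnj \<alpha> *\<^sub>C op_a \<pi> v)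
    = L (jacobi_elem s \<alpha> 0 0)"
proof -
  let ?s = "jacobi_elem 1 0 0 0" and ?p = "jacobi_elem 0 1 0 0" and ?q = "jacobi_elem 0 \<i> 0 0"
  have "jacobi_elem s \<alpha> 0 0 = s *\<^sub>R ?s + (Re \<alpha> *\<^sub>R ?p + Im \<alpha> *\<^sub>R ?q)" for s \<alpha>
    by (simp add: jacobi_elem_def mat2_eq_iff complex_eq_iff)
  then have L: "L (jacobi_elem s \<alpha> 0 0) = s *\<^sub>R L ?s + (Re \<alpha> *\<^sub>R L ?p + Im \<alpha> *\<^sub>R L ?q)" for s \<alpha>
    by (metis linear_add[OF orbit_derivative_linear] linear_scale[OF orbit_derivative_linear])
  have "op_ad \<pi> v = (1/2) *\<^sub>C L ?p + (-\<i>/2) *\<^sub>C L ?q" "op_a \<pi> v = (-1/2) *\<^sub>C L ?p + (-\<i>/2) *\<^sub>C L ?q"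
    using L[of 0 "1/2"] L[of 0 "-1/2"] L[of 0 "-\<i>/2"]
    by (simp_all add: op_a_def op_ad_def dpi_C_def gen_defs dpi_elem scaleR_conv_scaleC scaleC_scaleC
        scaleC.zero_left scaleC.zero_right)
  moreover have "(\<i> * complex_of_real s) *\<^sub>C op_I \<pi> v = s *\<^sub>R L ?s"
  proof -
    have "- (\<i> * complex_of_real s * \<i>) = complex_of_real s"
      by (simp add: complex_eq_iff)
    then show ?thesis
      using L[of "-1" 0]
      by (simp add: op_I_def dpi_C_def gen_defs dpi_elem dpi_zero scaleR_conv_scaleC scaleC_scaleC
        scaleC.zero_left scaleC.zero_right)
  qed
  ultimately show ?thesis
    by (simp only: L[of s \<alpha>] scaleC_real_combination)
qed

lemma op_rot: "(2 * \<i> * complex_of_real \<theta>) *\<^sub>C op_K0 \<pi> v = L (jacobi_elem 0 0 \<theta> 0)"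
proof -
  have "jacobi_elem 0 0 \<theta> 0 = (- 2 * \<theta>) *\<^sub>R jacobi_elem 0 0 (- 1 / 2) 0"
    by (simp add: jacobi_elem_def mat2_eq_iff complex_eq_iff)
  then have "L (jacobi_elem 0 0 \<theta> 0) = complex_of_real (- 2 * \<theta>) *\<^sub>C L (jacobi_elem 0 0 (- 1 / 2) 0)"
    by (metis linear_scale[OF orbit_derivative_linear] scaleC_of_real)
  moreover have "(2 * \<i> * complex_of_real \<theta>) *\<^sub>C \<i> *\<^sub>C z = complex_of_real (- 2 * \<theta>) *\<^sub>C z" for z :: 'h
    unfolding scaleC_scaleC by (rule arg_cong[of _ _ "\<lambda>c. c *\<^sub>C z"]) (simp add: complex_eq_iff)
  ultimately show ?thesis
    by (simp add: op_K0_def dpi_C_def gen_defs dpi_elem dpi_zero)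
qed

lemma op_boost: "y *\<^sub>C op_Kp \<pi> v - cnj y *\<^sub>C op_Km \<pi> v = L (jacobi_elem 0 0 0 y)"
proof -
  let ?p = "jacobi_elem 0 0 0 1" and ?q = "jacobi_elem 0 0 0 \<i>"
  have "jacobi_elem 0 0 0 y = Re y *\<^sub>R ?p + Im y *\<^sub>R ?q" for y
    by (simp add: jacobi_elem_def mat2_eq_iff complex_eq_iff)
  then have L: "L (jacobi_elem 0 0 0 y) = Re y *\<^sub>R L ?p + Im y *\<^sub>R L ?q" for y
    by (metis linear_add[OF orbit_derivative_linear] linear_scale[OF orbit_derivative_linear])
  have "op_Kp \<pi> v = (1/2) *\<^sub>C L ?p + (-\<i>/2) *\<^sub>C L ?q" "op_Km \<pi> v = (-1/2) *\<^sub>C L ?p + (-\<i>/2) *\<^sub>C L ?q"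
    using L[of "1/2"] L[of "-1/2"] L[of "-\<i>/2"]
    by (simp_all add: op_Kp_def op_Km_def dpi_C_def gen_defs dpi_elem scaleR_conv_scaleC scaleC_scaleC
        scaleC.zero_left scaleC.zero_right)
  then show ?thesis
    by (simp only: L[of y] scaleC_real_combination)
qed

end


section \<open>Exponentials and the operators T\<close>

lemma unitary_group_one_param_subgroup:
  assumes rep: "unitary_rep \<pi>" and \<gamma>: "one_param_subgroup \<gamma> X"
  shows "unitary_group (\<lambda>t. \<pi> (\<gamma> t))"
proof -
  have car: "\<gamma> t \<in> carrier jacobi_group" for t
    using \<gamma> by (simp add: one_param_subgroup_def)
  have "continuous_on UNIV \<gamma>"
    using one_param_subgroup_shift[OF \<gamma>]
    by (meson continuous_at_imp_continuous_on has_vector_derivative_continuous)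
  then have "continuous_on UNIV (\<lambda>t. \<pi> (\<gamma> t) v)" for v
    using rep car continuous_on_compose2[of "carrier jacobi_group" "\<lambda>g. \<pi> g v" UNIV \<gamma>]
    by (auto simp: unitary_rep_def)
  moreover have "\<pi> (\<gamma> (s + t)) = \<pi> (\<gamma> s) \<circ> \<pi> (\<gamma> t)" for s t
    using \<gamma> car rep_mult[OF rep] by (auto simp: one_param_subgroup_def fun_eq_iff)
  ultimately show ?thesis
    using rep_unitary[OF rep car] by (simp add: unitary_group_def)
qed

text \<open>A competing group agrees with \<open>\<pi>\<close> along \<open>\<gamma>\<close> on
  smooth vectors. These contain all multiples of the orbit of \<open>e\<close>, and the set of
  agreement is a closed subspace, so cyclicity makes it everything. Invariance of the smooth vectors
  is available for \<open>\<pi>\<close> only, which is the side on which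
  \<open>unitary_group_unique\<close> asks for it.\<close>

lemma op_exp_smooth_vectors:
  assumes rep: "unitary_rep \<pi>" and e: "e \<in> smooth_vectors \<pi>" "cyclic_vector \<pi> e"
    and \<gamma>: "one_param_subgroup \<gamma> X"
    and A: "\<And>v. v \<in> smooth_vectors \<pi> \<Longrightarrow> A v = dpi \<pi> X v"
  shows "op_exp (smooth_vectors \<pi>) A = \<pi> (\<gamma> 1)"
proof -
  let ?U = "\<lambda>t. \<pi> (\<gamma> t)" and ?D = "smooth_vectors \<pi>"
  have car: "\<gamma> t \<in> carrier jacobi_group" for t
    using \<gamma> by (simp add: one_param_subgroup_def)
  have U: "unitary_group ?U"
    by (rule unitary_group_one_param_subgroup[OF rep \<gamma>])
  have dU: "((\<lambda>t. ?U t v) has_vector_derivative A v) (at 0)" if v: "v \<in> ?D" for v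
  proof -
    obtain L where L: "orbit_derivative \<pi> \<one>\<^bsub>jacobi_group\<^esub> v L"
      using orbit_derivative_exists[OF v] by blast
    show ?thesis
      using one_param_subgroup_orbit[OF L \<gamma>] by (simp add: A[OF v] dpi_eq[OF L \<gamma>])
  qed
  have uniq: "V = ?U" if V: "unitary_group V" "\<forall>v\<in>?D. ((\<lambda>t. V t v) has_vector_derivative A v) (at 0)" for V
  proof (intro ext)
    fix t v
    have Vt: "unitary_op (V t)"
      using V(1) by (simp add: unitary_group_def)
    note blV = unitary_op_bounded_linear[OF Vt] and blU = unitary_op_bounded_linear[OF rep_unitary[OF rep car]]
    let ?M = "{v. V t v = ?U t v}"
    have D: "?D \<subseteq> ?M"
      using unitary_group_unique[OF U V(1) dU] V(2) smooth_vectors_rep[OF rep _ car] by blast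
    have "subspace ?M"
      by (auto simp: subspace_def linear_0 linear_add linear_scale bounded_linear.linear blV blU)
    moreover have "{c *\<^sub>C \<pi> g e | c g. g \<in> carrier jacobi_group} \<subseteq> ?M"
      using D smooth_vectors_scaleC[OF rep smooth_vectors_rep[OF rep e(1)]] by blast
    ultimately have "span {c *\<^sub>C \<pi> g e | c g. g \<in> carrier jacobi_group} \<subseteq> ?M"
      by (rule span_minimal[rotated])
    moreover have "closed ?M"
      by (intro closed_Collect_eq linear_continuous_on blV blU)
    ultimately have "?M = UNIV"
      using e(2) closure_minimal unfolding cyclic_vector_def by blast
    then show "V t v = ?U t v" by blast
  qed
  have "(THE U. unitary_group U \<and> (\<forall>v\<in>?D. ((\<lambda>t. U t v) has_vector_derivative A v) (at 0))) = ?U"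
    using U dU by (intro the_equality conjI ballI uniq) simp_all
  then show ?thesis
    by (simp only: op_exp_def)
qed

section \<open>The boost belonging to a point of the Siegel disk\<close>

lemma tanh_artanh_real:
  assumes "\<bar>x::real\<bar> < 1" shows "tanh (artanh x) = x"
proof -
  have "- 2 * artanh x = - ln ((1 + x) / (1 - x))"
    by (simp add: artanh_def)
  then have "exp (- 2 * artanh x) = (1 - x) / (1 + x)"
    using assms by (simp add: exp_minus)
  then have "tanh (artanh x) = (1 - (1 - x) / (1 + x)) / (1 + (1 - x) / (1 + x))"
    by (simp only: tanh_real_altdef)
  also have "\<dots> = x"
    using assms by (simp add: field_simps)
  finally show ?thesis .
qed

text \<open>Along each ray the defining map is \<open>tanh\<close> of the modulus, inverted by
  \<open>artanh\<close>; direction and modulus determine the solution separately. The default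
  \<open>sgn 0 = 0\<close> absorbs the case distinction of the definition.\<close>

lemma siegel_zeta:
  assumes "cmod w < 1"
  shows "sgn (siegel_zeta w) * of_real (tanh (cmod (siegel_zeta w))) = w"
proof -
  let ?z = "sgn w * complex_of_real (artanh (cmod w))"
  have eq: "(if \<zeta> = 0 then 0 else \<zeta> / complex_of_real (cmod \<zeta>) * complex_of_real (tanh (cmod \<zeta>)))
      = sgn \<zeta> * of_real (tanh (cmod \<zeta>))" for \<zeta>
    by (simp add: sgn_eq)
  have artanh: "artanh (cmod w) \<ge> 0" "tanh (artanh (cmod w)) = cmod w"
    using assms tanh_artanh_real[of "cmod w"] by (simp_all add: artanh_def)
  have z: "sgn ?z * of_real (tanh (cmod ?z)) = w"
  proof (cases "w = 0")
    case False
    then have "cmod ?z = artanh (cmod w)" "artanh (cmod w) \<noteq> 0"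
      using artanh by (auto simp: norm_mult norm_sgn)
    then show ?thesis
      using artanh False by (simp add: sgn_mult sgn_of_real sgn_eq)
  qed simp
  have uniq: "\<zeta> = ?z" if "w = sgn \<zeta> * of_real (tanh (cmod \<zeta>))" for \<zeta>
  proof (cases "\<zeta> = 0")
    case True
    then show ?thesis using that by simp
  next
    case False
    then have "cmod w = tanh (cmod \<zeta>)" "sgn w = sgn \<zeta>"
      using that by (auto simp: norm_mult norm_sgn sgn_mult sgn_of_real)
    then show ?thesis
      by (simp add: artanh_tanh_real sgn_eq)
  qed
  have "siegel_zeta w = ?z"
    unfolding siegel_zeta_def eq by (rule the_equality, rule z[symmetric], erule uniq)
  then show "sgn (siegel_zeta w) * of_real (tanh (cmod (siegel_zeta w))) = w"
    using z by simp
qed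

text \<open>In the disk this is the positive definite element of \<open>SU11\<close> whose Moebius
  transformation takes 0 to \<open>w\<close>.\<close>

definition siegel_matrix :: "complex \<Rightarrow> complex^2^2" where
  "siegel_matrix w = (let r = complex_of_real (1 / sqrt (1 - (cmod w)\<^sup>2)) in mat2 r (r * w) (r * cnj w) r)"

lemma boost_curve_siegel_zeta:
  assumes "cmod w < 1"
  shows "boost_curve (siegel_zeta w) 1 = (0, siegel_matrix w)"
proof -
  define z where "z = siegel_zeta w"
  let ?c = "cosh (cmod z)"
  have w: "sgn z * of_real (tanh (cmod z)) = w"
    using siegel_zeta[OF assms] by (simp add: z_def)
  then have cw: "cmod w = tanh (cmod z)"
    by (auto simp: norm_mult norm_sgn)
  have c0: "?c > 0" by (rule cosh_real_pos)
  \<comment> \<open>As \<open>cmod w\<close> is a hyperbolic tangent,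
    \<open>1 - (cmod w)\<^sup>2\<close> is the inverse square of the hyperbolic cosine: the
    normalizing factor of \<open>siegel_matrix\<close> is the diagonal entry of the boost.\<close>
  have "1 - (cmod w)\<^sup>2 = (?c\<^sup>2 - (sinh (cmod z))\<^sup>2) / ?c\<^sup>2"
    using c0 by (simp add: cw tanh_def power_divide diff_divide_distrib)
  then have "1 - (cmod w)\<^sup>2 = (1 / ?c)\<^sup>2"
    by (simp add: hyperbolic_pythagoras power_divide)
  then have c: "1 / sqrt (1 - (cmod w)\<^sup>2) = ?c"
    using c0 by (simp add: real_sqrt_divide)
  have "complex_of_real (sinh (cmod z)) = of_real ?c * of_real (tanh (cmod z))"
    using c0 by (simp add: tanh_def)
  then have "sgn z * of_real (sinh (cmod z)) = of_real ?c * w"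
    "cnj (sgn z) * of_real (sinh (cmod z)) = of_real ?c * cnj w"
    by (simp_all flip: w)
  then show ?thesis
    by (simp add: boost_curve_def siegel_matrix_def c Let_def flip: z_def)
qed

lemma siegel_matrix_SU11:
  assumes "cmod w < 1" shows "siegel_matrix w \<in> SU11"
proof -
  have "boost_curve (siegel_zeta w) 1 \<in> carrier jacobi_group"
    using one_param_subgroup_boost unfolding one_param_subgroup_def by blast
  then show ?thesis
    by (simp only: boost_curve_siegel_zeta[OF assms] carrier_jacobi_iff snd_conv)
qed

text \<open>\<open>D\<close> and \<open>S\<close> are time-one values of the Heisenberg and boost
  subgroups. The boost has no translation part, so their product acquires no cocycle term and its
  central coordinate stays 0.\<close>

lemma op_T_eq:
  assumes rep: "unitary_rep \<pi>" and e: "e \<in> smooth_vectors \<pi>" "cyclic_vector \<pi> e" and w: "cmod w < 1"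
  shows "op_T \<pi> (\<alpha>, w) v = \<pi> ((\<alpha>, 0), siegel_matrix w) v"
proof -
  have D: "op_D \<pi> \<alpha> = \<pi> (heis_curve 0 \<alpha> 1)"
    unfolding op_D_def
  proof (rule op_exp_smooth_vectors[OF rep e one_param_subgroup_heis])
    fix v assume "v \<in> smooth_vectors \<pi>"
    then obtain L where "orbit_derivative \<pi> \<one>\<^bsub>jacobi_group\<^esub> v L"
      using orbit_derivative_exists by blast
    then show "\<alpha> *\<^sub>C op_ad \<pi> v - cnj \<alpha> *\<^sub>C op_a \<pi> v = dpi \<pi> (jacobi_elem 0 \<alpha> 0 0) v"
      using op_heis[of \<pi> v L 0 \<alpha>] dpi_elem(1)[of \<pi> v L 0 \<alpha>] by (simp add: scaleC.zero_left)
  qed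
  have S: "op_S \<pi> w = \<pi> (boost_curve (siegel_zeta w) 1)"
    unfolding op_S_def
  proof (rule op_exp_smooth_vectors[OF rep e one_param_subgroup_boost])
    fix v assume "v \<in> smooth_vectors \<pi>"
    then obtain L where "orbit_derivative \<pi> \<one>\<^bsub>jacobi_group\<^esub> v L"
      using orbit_derivative_exists by blast
    then show "siegel_zeta w *\<^sub>C op_Kp \<pi> v - cnj (siegel_zeta w) *\<^sub>C op_Km \<pi> v
        = dpi \<pi> (jacobi_elem 0 0 0 (siegel_zeta w)) v"
      by (simp only: op_boost dpi_elem(3))
  qed
  have "heis_curve 0 \<alpha> 1 \<odot> boost_curve (siegel_zeta w) 1 = ((\<alpha>, 0), siegel_matrix w)"
    unfolding jacobi_mult_eq boost_curve_siegel_zeta[OF w]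
    by (simp add: heis_curve_def mat_act_def)
  then show ?thesis
    using rep_mult[OF rep, of "heis_curve 0 \<alpha> 1" "boost_curve (siegel_zeta w) 1" v]
      one_param_subgroup_heis[of 0 \<alpha>] one_param_subgroup_boost[of "siegel_zeta w"]
    by (simp add: op_T_def D S one_param_subgroup_def)
qed


section \<open>The Schroedinger equation\<close>

lemma jacobi_mult_deriv_add:
  "jacobi_mult_deriv x (a + b) y 0 = jacobi_mult_deriv x a y 0 + jacobi_mult_deriv x b y 0"
  "jacobi_mult_deriv x 0 y (a + b) = jacobi_mult_deriv x 0 y a + jacobi_mult_deriv x 0 y b"
  by (simp_all add: jacobi_mult_deriv_def Let_def mat_act_def prod_eq_iff mat2_eq_iff
      matrix_matrix_mult_def sum_2 algebra_simps)

text \<open>\<open>\<rho>\<close> is the logarithmic derivative of the normalizing factor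
  \<open>r\<close>, characterized by a product to avoid a quotient; the entries are then the product
  rule for \<open>r\<close> and \<open>r * w\<close>.\<close>

lemma siegel_matrix_has_vector_derivative:
  assumes u: "(u has_real_derivative u') (at t within T)" and v: "(v has_real_derivative v') (at t within T)"
    and disk: "(u t)\<^sup>2 + (v t)\<^sup>2 < 1" and \<rho>: "u t * u' + v t * v' = \<rho> * (1 - (u t)\<^sup>2 - (v t)\<^sup>2)"
  defines "r \<equiv> complex_of_real (1 / sqrt (1 - (cmod (Complex (u t) (v t)))\<^sup>2))"
  shows "((\<lambda>s. siegel_matrix (Complex (u s) (v s))) has_vector_derivative
    mat2 (r * \<rho>) (r * \<rho> * Complex (u t) (v t) + r * Complex u' v')
      (r * \<rho> * cnj (Complex (u t) (v t)) + r * cnj (Complex u' v')) (r * \<rho>)) (at t within T)"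
proof -
  let ?q = "\<lambda>s. 1 - (u s)\<^sup>2 - (v s)\<^sup>2"
  let ?r = "\<lambda>s. 1 / sqrt (?q s)"
  have cm: "1 - (cmod (Complex (u s) (v s)))\<^sup>2 = ?q s" for s
    by (simp add: cmod_power2)
  have pos: "?q t > 0" using disk by simp
  have "(?q has_real_derivative - 2 * (u t * u' + v t * v')) (at t within T)"
    by (auto intro!: derivative_eq_intros u v)
  moreover have "((\<lambda>s. 1 / sqrt (q s)) has_real_derivative - D / (2 * q t * sqrt (q t))) (at t within T)"
    if "(q has_real_derivative D) (at t within T)" "q t > 0" for q D
    using that by (auto intro!: derivative_eq_intros simp: field_simps)
  ultimately have "(?r has_real_derivative - (- 2 * (u t * u' + v t * v')) / (2 * ?q t * sqrt (?q t))) (at t within T)"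
    using pos by blast
  moreover have "- (- 2 * (u t * u' + v t * v')) / (2 * ?q t * sqrt (?q t)) = ?r t * \<rho>"
  proof -
    have "- (- 2 * (\<rho> * q)) / (2 * q * sqrt q) = 1 / sqrt q * \<rho>" if "q > 0" for q
      using that by simp
    then show ?thesis unfolding \<rho> using pos by blast
  qed
  ultimately have "(?r has_real_derivative ?r t * \<rho>) (at t within T)" by simp
  then have r: "((\<lambda>s. complex_of_real (?r s)) has_vector_derivative r * \<rho>) (at t within T)"
    unfolding has_vector_derivative_complex_iff by (simp add: r_def cm)
  have w: "((\<lambda>s. Complex (u s) (v s)) has_vector_derivative Complex u' v') (at t within T)"
    and cw: "((\<lambda>s. cnj (Complex (u s) (v s))) has_vector_derivative cnj (Complex u' v')) (at t within T)"
    unfolding has_vector_derivative_complex_iff by (auto intro: u v derivative_eq_intros)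
  have rt: "complex_of_real (?r t) = r" by (simp add: r_def cm)
  show ?thesis
    unfolding siegel_matrix_def Let_def cm
    using has_vector_derivative_mat2[OF r has_vector_derivative_mult[OF r w]
        has_vector_derivative_mult[OF r cw] r]
    by (simp only: rt add.commute)
qed

text \<open>The relation \<open>Z g = g' + g Y\<close>. In the upper left entry, divided by
  \<open>r\<close>, \<open>- \<i> * (b + p * cnj w)\<close> has real part \<open>\<rho>\<close>, the
  change of normalization, and imaginary part the rotation rate in \<open>Y\<close>. The
  off-diagonal entry then leaves the Riccati equation for \<open>w'\<close>. The translation part
  yields \<open>\<alpha>'\<close>, and the cocycle of \<open>- \<i> * cnj a\<close> with
  \<open>\<alpha>\<close> yields the central term \<open>- Re (a * \<alpha>)\<close>.\<close>

lemma siegel_jacobi_velocity: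
  fixes a p \<alpha> w :: complex and b :: real
  defines "r \<equiv> complex_of_real (1 / sqrt (1 - (cmod w)\<^sup>2))"
    and "\<rho> \<equiv> Im (p * cnj w)" and "\<alpha>' \<equiv> - \<i> * (cnj a + b * \<alpha> + p * cnj \<alpha>)"
    and "w' \<equiv> - \<i> * (p + 2 * b * w + cnj p * w\<^sup>2)"
  shows "jacobi_mult_deriv \<one>\<^bsub>jacobi_group\<^esub>
      (jacobi_elem 0 (- \<i> * cnj a) 0 0 + jacobi_elem 0 0 (- b) 0 + jacobi_elem 0 0 0 (- \<i> * p))
      ((\<alpha>, 0), siegel_matrix w) 0
    = ((\<alpha>', 0), mat2 (r * \<rho>) (r * \<rho> * w + r * w') (r * \<rho> * cnj w + r * cnj w') (r * \<rho>))
      + jacobi_mult_deriv ((\<alpha>, 0), siegel_matrix w) 0 \<one>\<^bsub>jacobi_group\<^esub>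
          (jacobi_elem (- Re (a * \<alpha>)) 0 0 0 + jacobi_elem 0 0 (- (b + Re (p * cnj w))) 0)"
proof -
  have M: "siegel_matrix w = mat2 r (r * w) (r * cnj w) r"
    by (simp add: siegel_matrix_def r_def Let_def)
  show ?thesis
    unfolding M jacobi_mult_deriv_def jacobi_one jacobi_elem_def mat1_eq_mat2 Let_def
    by (simp add: prod_eq_iff mat2_eq_iff matrix_matrix_mult_def sum_2 mat_act_def \<alpha>'_def w'_def,
        intro conjI; simp add: complex_eq_iff \<rho>_def power2_eq_square algebra_simps)
qed

text \<open>\<open>op_K0\<close> is defined through derivatives of curves, so homogeneity is drawn
  from the differential of the orbit of \<open>c *\<^sub>C v\<close>. It keeps \<open>\<Phi>\<close>
  an eigenvector after multiplication by the phase. The angle \<open>1/2\<close> makes the factor in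
  \<open>op_rot\<close> equal to \<open>\<i>\<close>.\<close>

lemma op_K0_scaleC:
  assumes rep: "unitary_rep \<pi>" and v: "v \<in> smooth_vectors \<pi>"
  shows "op_K0 \<pi> (c *\<^sub>C v) = c *\<^sub>C op_K0 \<pi> v"
proof -
  obtain L where L: "orbit_derivative \<pi> \<one>\<^bsub>jacobi_group\<^esub> v L"
    using orbit_derivative_exists[OF v] by blast
  have "\<i> *\<^sub>C op_K0 \<pi> (c *\<^sub>C v) = c *\<^sub>C \<i> *\<^sub>C op_K0 \<pi> v"
    using op_rot[OF L, of "1/2"] op_rot[OF orbit_derivative_scaleC[OF rep L, of c], of "1/2"]
    by simp
  then have "\<i> *\<^sub>C op_K0 \<pi> (c *\<^sub>C v) = \<i> *\<^sub>C c *\<^sub>C op_K0 \<pi> v"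
    by (simp add: scaleC_scaleC mult.commute)
  then have "(- \<i>) *\<^sub>C \<i> *\<^sub>C op_K0 \<pi> (c *\<^sub>C v) = (- \<i>) *\<^sub>C \<i> *\<^sub>C c *\<^sub>C op_K0 \<pi> v"
    by simp
  then show ?thesis
    by (simp add: scaleC_scaleC scaleC_one)
qed

text \<open>\<open>L'\<close> at the displayed vector is the part of \<open>H\<^sub>0 \<psi>\<close>
  produced by the motion of \<open>(\<alpha>, w)\<close>; the scalar remainder is the rate at which
  the phase must turn.\<close>

lemma hamiltonian_orbit:
  fixes a p \<alpha> w :: complex and b k :: real
  assumes rep: "unitary_rep \<pi>" and I: "\<forall>v\<in>smooth_vectors \<pi>. op_I \<pi> v = v"
    and \<Phi>: "\<Phi> \<in> smooth_vectors \<pi>" "op_K0 \<pi> \<Phi> = complex_of_real k *\<^sub>C \<Phi>" and w: "cmod w < 1"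
    and L': "orbit_derivative \<pi> ((\<alpha>, 0), siegel_matrix w) \<Phi> L'"
  defines "r \<equiv> complex_of_real (1 / sqrt (1 - (cmod w)\<^sup>2))"
    and "\<rho> \<equiv> Im (p * cnj w)" and "\<alpha>' \<equiv> - \<i> * (cnj a + b * \<alpha> + p * cnj \<alpha>)"
    and "w' \<equiv> - \<i> * (p + 2 * b * w + cnj p * w\<^sup>2)"
    and "\<psi> \<equiv> \<pi> ((\<alpha>, 0), siegel_matrix w) \<Phi>"
  shows "a *\<^sub>C op_a \<pi> \<psi> + cnj a *\<^sub>C op_ad \<pi> \<psi> + (2 * complex_of_real b) *\<^sub>C op_K0 \<pi> \<psi>
      + p *\<^sub>C op_Kp \<pi> \<psi> + cnj p *\<^sub>C op_Km \<pi> \<psi>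
    = \<i> *\<^sub>C L' ((\<alpha>', 0), mat2 (r * \<rho>) (r * \<rho> * w + r * w') (r * \<rho> * cnj w + r * cnj w') (r * \<rho>))
      + complex_of_real (Re (a * \<alpha>) + 2 * k * (b + Re (p * cnj w))) *\<^sub>C \<psi>"
proof -
  let ?g = "((\<alpha>, 0), siegel_matrix w)" and ?one = "\<one>\<^bsub>jacobi_group\<^esub>"
  let ?Z1 = "jacobi_elem 0 (- \<i> * cnj a) 0 0" and ?Z2 = "jacobi_elem 0 0 (- b) 0"
    and ?Z3 = "jacobi_elem 0 0 0 (- \<i> * p)"
  let ?\<kappa> = "b + Re (p * cnj w)"
  let ?Y1 = "jacobi_elem (- Re (a * \<alpha>)) 0 0 0" and ?Y2 = "jacobi_elem 0 0 (- ?\<kappa>) 0"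
  let ?V = "((\<alpha>', 0), mat2 (r * \<rho>) (r * \<rho> * w + r * w') (r * \<rho> * cnj w + r * cnj w') (r * \<rho>))"
  have g: "?g \<in> carrier jacobi_group"
    by (simp add: carrier_jacobi_iff siegel_matrix_SU11[OF w])
  have \<psi>: "\<psi> \<in> smooth_vectors \<pi>"
    unfolding \<psi>_def by (rule smooth_vectors_rep[OF rep \<Phi>(1) g])
  obtain L\<^sub>1 where L1: "orbit_derivative \<pi> ?one \<psi> L\<^sub>1"
    using orbit_derivative_exists[OF \<psi>] by blast
  obtain L\<^sub>0 where L0: "orbit_derivative \<pi> ?one \<Phi> L\<^sub>0"
    using orbit_derivative_exists[OF \<Phi>(1)] by blast
  have lin: "linear L'" using L' by (simp add: orbit_derivative_def)
  note right = orbit_derivative_right[OF rep g L1[unfolded \<psi>_def] L']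
  note left = orbit_derivative_left[OF rep g L0 L']
  \<comment> \<open>The three generators are moved to \<open>?g\<close> one by one, each along its
    own subgroup, and added only there.\<close>
  have "L\<^sub>1 ?Z1 + L\<^sub>1 ?Z2 + L\<^sub>1 ?Z3 = L' (jacobi_mult_deriv ?one (?Z1 + ?Z2 + ?Z3) ?g 0)"
    by (simp only: right[OF one_param_subgroup_heis] right[OF one_param_subgroup_rot]
        right[OF one_param_subgroup_boost] jacobi_mult_deriv_add linear_add[OF lin])
  also have "\<dots> = L' (?V + jacobi_mult_deriv ?g 0 ?one (?Y1 + ?Y2))"
    unfolding r_def \<rho>_def \<alpha>'_def w'_def by (subst siegel_jacobi_velocity) (rule refl)
  \<comment> \<open>In \<open>g Y\<close> the element \<open>Y\<close> acts before
    \<open>\<pi> ?g\<close>, hence on \<open>\<Phi>\<close> itself: the centre acts by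
    \<open>op_I\<close> as the identity, the rotation by the eigenvalue \<open>k\<close>, with the
    factor 2 of \<open>2 * \<i> * \<theta>\<close> in front of \<open>K\<^sub>0\<close>.\<close>
  also have "\<dots> = L' ?V + (\<pi> ?g (L\<^sub>0 ?Y1) + \<pi> ?g (L\<^sub>0 ?Y2))"
    by (simp only: left[OF one_param_subgroup_heis] left[OF one_param_subgroup_rot]
        jacobi_mult_deriv_add linear_add[OF lin])
  also have "L\<^sub>0 ?Y1 = (- \<i> * Re (a * \<alpha>)) *\<^sub>C \<Phi>"
  proof -
    have "L\<^sub>0 ?Y1 = (\<i> * complex_of_real (- Re (a * \<alpha>))) *\<^sub>C \<Phi>"
      unfolding op_heis[OF L0, symmetric] using I \<Phi>(1) by (simp add: scaleC.zero_left)
    then show ?thesis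
      by (simp only: of_real_minus mult_minus_right mult_minus_left)
  qed
  also have "L\<^sub>0 ?Y2 = (- \<i> * (2 * k * ?\<kappa>)) *\<^sub>C \<Phi>"
    unfolding op_rot[OF L0, symmetric] \<Phi>(2) scaleC_scaleC
    by (rule arg_cong[of _ _ "\<lambda>c. c *\<^sub>C \<Phi>"]) (simp add: complex_eq_iff algebra_simps)
  finally have "\<i> *\<^sub>C (L\<^sub>1 ?Z1 + L\<^sub>1 ?Z2 + L\<^sub>1 ?Z3)
      = \<i> *\<^sub>C (L' ?V + ((- \<i> * Re (a * \<alpha>)) *\<^sub>C \<psi> + (- \<i> * (2 * k * ?\<kappa>)) *\<^sub>C \<psi>))"
    by (simp only: rep_scaleC[OF rep g] \<psi>_def)
  also have "\<dots> = \<i> *\<^sub>C L' ?V + complex_of_real (Re (a * \<alpha>) + 2 * k * ?\<kappa>) *\<^sub>C \<psi>"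
    unfolding scaleC_add_right scaleC_scaleC add_left_cancel scaleC_add_left[symmetric]
    by (rule arg_cong[of _ _ "\<lambda>c. c *\<^sub>C \<psi>"]) (simp add: complex_eq_iff)
  also have "\<i> *\<^sub>C (L\<^sub>1 ?Z1 + L\<^sub>1 ?Z2 + L\<^sub>1 ?Z3)
      = a *\<^sub>C op_a \<pi> \<psi> + cnj a *\<^sub>C op_ad \<pi> \<psi> + (2 * complex_of_real b) *\<^sub>C op_K0 \<pi> \<psi>
      + p *\<^sub>C op_Kp \<pi> \<psi> + cnj p *\<^sub>C op_Km \<pi> \<psi>"
  proof -
    have "L\<^sub>1 ?Z1 = (- \<i> * cnj a) *\<^sub>C op_ad \<pi> \<psi> - (\<i> * a) *\<^sub>C op_a \<pi> \<psi>"
      using op_heis[OF L1, of 0 "- \<i> * cnj a"] by (simp add: scaleC.zero_left)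
    moreover have "L\<^sub>1 ?Z2 = - ((2 * \<i> * b) *\<^sub>C op_K0 \<pi> \<psi>)"
      using op_rot[OF L1, of "- b"] by (simp add: scaleC.minus_left)
    moreover have "L\<^sub>1 ?Z3 = (- \<i> * p) *\<^sub>C op_Kp \<pi> \<psi> - (\<i> * cnj p) *\<^sub>C op_Km \<pi> \<psi>"
      using op_boost[OF L1, of "- \<i> * p"] by simp
    moreover have "\<i> * (- \<i> * cnj a) = cnj a" "\<i> * (\<i> * a) = - a" "\<i> * (2 * \<i> * b) = - (2 * b)"
      "\<i> * (- \<i> * p) = p" "\<i> * (\<i> * cnj p) = - cnj p"
      by (simp_all add: complex_eq_iff)
    ultimately show ?thesis
      by (simp only: scaleC_add_right scaleC.diff_right scaleC_scaleC scaleC.minus_left scaleC.minus_right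
          diff_minus_eq_add add_ac of_real_mult of_real_numeral of_real_minus minus_minus)
  qed
  finally show ?thesis .
qed

theorem proposition1:
  fixes \<pi> :: "jacobi \<Rightarrow> 'h::complex_hilbert_space \<Rightarrow> 'h"
    and \<epsilon>a \<epsilon>0 \<epsilon>p \<epsilon>m :: "real \<Rightarrow> complex"
    and e0 e1 e2 \<nu>1 \<nu>2 :: "real \<Rightarrow> real"
    and H0 :: "real \<Rightarrow> 'h \<Rightarrow> 'h"
    and hbar :: real and J :: "real set"
  assumes rep: "positive_discrete_rep \<pi>"
    and hbar: "hbar > 0"
    and J: "is_interval J"
    and \<epsilon>m: "\<And>\<tau>. cnj (\<epsilon>p \<tau>) = \<epsilon>m \<tau>"
    and \<epsilon>0: "\<And>\<tau>. cnj (\<epsilon>0 \<tau>) = \<epsilon>0 \<tau>"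
    and \<nu>: "\<And>\<tau>. \<epsilon>a \<tau> = complex_of_real (\<nu>1 \<tau>) + \<i> * complex_of_real (\<nu>2 \<tau>)"
    and e0: "\<And>\<tau>. \<epsilon>0 \<tau> = 2 * complex_of_real (e0 \<tau>)"
    and e12: "\<And>\<tau>. \<epsilon>p \<tau> = complex_of_real (e1 \<tau>) - \<i> * complex_of_real (e2 \<tau>)"
    and H0: "\<And>\<tau> \<psi>. H0 \<tau> \<psi> =
      \<epsilon>a \<tau> *\<^sub>C op_a \<pi> \<psi> + cnj (\<epsilon>a \<tau>) *\<^sub>C op_ad \<pi> \<psi> + \<epsilon>0 \<tau> *\<^sub>C op_K0 \<pi> \<psi>
      + \<epsilon>p \<tau> *\<^sub>C op_Kp \<pi> \<psi> + \<epsilon>m \<tau> *\<^sub>C op_Km \<pi> \<psi>"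
  shows
    "(\<forall>\<tau>. \<forall>\<psi>\<in>smooth_vectors \<pi>. H0 \<tau> \<psi> =
       (2 * e0 \<tau>) *\<^sub>R op_K0 \<pi> \<psi> + (2 * e1 \<tau>) *\<^sub>R op_K1 \<pi> \<psi> + (2 * e2 \<tau>) *\<^sub>R op_K2 \<pi> \<psi>
       + \<nu>1 \<tau> *\<^sub>R op_N1 \<pi> \<psi> + \<nu>2 \<tau> *\<^sub>R op_N2 \<pi> \<psi>) \<and>
     (\<forall>(\<Phi>::'h) (k::real) (x::real \<Rightarrow> real) y u v \<phi>.
       \<Phi> \<in> smooth_vectors \<pi> \<and> op_K0 \<pi> \<Phi> = complex_of_real k *\<^sub>C \<Phi> \<and>
       (\<forall>\<tau>\<in>J. (u \<tau>)\<^sup>2 + (v \<tau>)\<^sup>2 < 1 \<and>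
          xy_eqs J e0 e1 e2 \<nu>1 \<nu>2 x y \<tau> \<and> uv_eqs J e0 e1 e2 u v \<tau> \<and>
          phase_eq J k e0 e1 e2 \<nu>1 \<nu>2 x y u v \<phi> \<tau>) \<longrightarrow>
       (let \<xi> = (\<lambda>\<tau>. (Complex (x \<tau>) (y \<tau>), Complex (u \<tau>) (v \<tau>)));
            \<Psi> = (\<lambda>t. exp (- \<i> * complex_of_real (\<phi> (t / hbar))) *\<^sub>C op_T \<pi> (\<xi> (t / hbar)) \<Phi>);
            I = {t. t / hbar \<in> J}
        in \<forall>t\<in>I. \<Psi> t \<in> smooth_vectors \<pi> \<and>
             (\<exists>d\<Psi>. (\<Psi> has_vector_derivative d\<Psi>) (at t within I) \<and>
                   H0 (t / hbar) (\<Psi> t) = (\<i> * complex_of_real hbar) *\<^sub>C d\<Psi>))) \<and>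
     (\<forall>(u::real \<Rightarrow> real) v. \<forall>\<tau>\<in>J. (u \<tau>)\<^sup>2 + (v \<tau>)\<^sup>2 < 1 \<longrightarrow>
       (let w = (\<lambda>s. Complex (u s) (v s)) in
        uv_eqs J e0 e1 e2 u v \<tau> \<longleftrightarrow>
        (\<exists>dw. (w has_vector_derivative dw) (at \<tau> within J) \<and>
              \<i> * dw = \<epsilon>p \<tau> + \<epsilon>0 \<tau> * w \<tau> + \<epsilon>m \<tau> * (w \<tau>)\<^sup>2))) \<and>
     (\<forall>(x::real \<Rightarrow> real) y. \<forall>\<tau>\<in>J.
       (let \<eta> = (\<lambda>s. Complex (x s) (y s)) in
        xy_eqs J e0 e1 e2 \<nu>1 \<nu>2 x y \<tau> \<longleftrightarrow>
        (\<exists>d\<eta>. (\<eta> has_vector_derivative d\<eta>) (at \<tau> within J) \<and>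
              \<i> * d\<eta> = cnj (\<epsilon>a \<tau>) + \<epsilon>p \<tau> * cnj (\<eta> \<tau>) + \<epsilon>0 \<tau> / 2 * \<eta> \<tau>)))"
proof (intro conjI)
  \<comment> \<open>Each real system is the pair of real and imaginary parts of one complex equation
    solved for the derivative. This form serves both the stated equivalences and the differentiation
    of the group curve.\<close>
  have xy: "xy_eqs J e0 e1 e2 \<nu>1 \<nu>2 x y \<tau> \<longleftrightarrow> ((\<lambda>s. Complex (x s) (y s)) has_vector_derivative
      - \<i> * (cnj (\<epsilon>a \<tau>) + \<epsilon>p \<tau> * cnj (Complex (x \<tau>) (y \<tau>)) + e0 \<tau> * Complex (x \<tau>) (y \<tau>))) (at \<tau> within J)" for x y \<tau>
    unfolding xy_eqs_def has_vector_derivative_complex_iff by (simp add: \<nu> e12 algebra_simps)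
  have uv: "uv_eqs J e0 e1 e2 u v \<tau> \<longleftrightarrow> ((\<lambda>s. Complex (u s) (v s)) has_vector_derivative
      - \<i> * (\<epsilon>p \<tau> + 2 * e0 \<tau> * Complex (u \<tau>) (v \<tau>) + cnj (\<epsilon>p \<tau>) * (Complex (u \<tau>) (v \<tau>))\<^sup>2)) (at \<tau> within J)" for u v \<tau>
    unfolding uv_eqs_def has_vector_derivative_complex_iff
    by (simp add: e12 power2_eq_square algebra_simps)
  have i_mult: "\<i> * d = z \<longleftrightarrow> d = - \<i> * z" for d z :: complex
    by (auto simp flip: mult.assoc)
  show "\<forall>\<tau>. \<forall>\<psi>\<in>smooth_vectors \<pi>. H0 \<tau> \<psi> =
       (2 * e0 \<tau>) *\<^sub>R op_K0 \<pi> \<psi> + (2 * e1 \<tau>) *\<^sub>R op_K1 \<pi> \<psi> + (2 * e2 \<tau>) *\<^sub>R op_K2 \<pi> \<psi>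
       + \<nu>1 \<tau> *\<^sub>R op_N1 \<pi> \<psi> + \<nu>2 \<tau> *\<^sub>R op_N2 \<pi> \<psi>"
    by (simp add: H0 op_K1_def op_K2_def op_N1_def op_N2_def scaleR_conv_scaleC scaleC_add_right
        scaleC_add_left scaleC.diff_left scaleC.diff_right scaleC.minus_left scaleC_scaleC e0 e12 \<nu> mult.commute flip: \<epsilon>m)
  show "\<forall>(u::real \<Rightarrow> real) v. \<forall>\<tau>\<in>J. (u \<tau>)\<^sup>2 + (v \<tau>)\<^sup>2 < 1 \<longrightarrow>
       (let w = (\<lambda>s. Complex (u s) (v s)) in
        uv_eqs J e0 e1 e2 u v \<tau> \<longleftrightarrow>
        (\<exists>dw. (w has_vector_derivative dw) (at \<tau> within J) \<and>
              \<i> * dw = \<epsilon>p \<tau> + \<epsilon>0 \<tau> * w \<tau> + \<epsilon>m \<tau> * (w \<tau>)\<^sup>2))"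
    by (simp only: Let_def uv i_mult e0 \<epsilon>m[symmetric]) simp
  show "\<forall>(x::real \<Rightarrow> real) y. \<forall>\<tau>\<in>J.
       (let \<eta> = (\<lambda>s. Complex (x s) (y s)) in
        xy_eqs J e0 e1 e2 \<nu>1 \<nu>2 x y \<tau> \<longleftrightarrow>
        (\<exists>d\<eta>. (\<eta> has_vector_derivative d\<eta>) (at \<tau> within J) \<and>
              \<i> * d\<eta> = cnj (\<epsilon>a \<tau>) + \<epsilon>p \<tau> * cnj (\<eta> \<tau>) + \<epsilon>0 \<tau> / 2 * \<eta> \<tau>))"
    by (simp only: Let_def xy i_mult e0) simp
  obtain e where ops: "unitary_rep \<pi>" "e \<in> smooth_vectors \<pi>" "cyclic_vector \<pi> e"
    and I: "\<forall>v\<in>smooth_vectors \<pi>. op_I \<pi> v = v"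
    using rep unfolding positive_discrete_rep_def lowest_weight_vector_def by blast
  let ?I = "{t. t / hbar \<in> J}"
  let ?\<xi> = "\<lambda>x y u v \<tau>. (Complex (x \<tau>) (y \<tau>), Complex (u \<tau>) (v \<tau>))"
  let ?\<Psi> = "\<lambda>\<Phi> x y u v \<phi> t. exp (- \<i> * complex_of_real (\<phi> (t / hbar))) *\<^sub>C op_T \<pi> (?\<xi> x y u v (t / hbar)) \<Phi>"
  have "?\<Psi> \<Phi> x y u v \<phi> t \<in> smooth_vectors \<pi> \<and>
      (\<exists>d\<Psi>. (?\<Psi> \<Phi> x y u v \<phi> has_vector_derivative d\<Psi>) (at t within ?I) \<and>
        H0 (t / hbar) (?\<Psi> \<Phi> x y u v \<phi> t) = (\<i> * complex_of_real hbar) *\<^sub>C d\<Psi>)"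
    if \<Phi>: "\<Phi> \<in> smooth_vectors \<pi>" "op_K0 \<pi> \<Phi> = complex_of_real k *\<^sub>C \<Phi>"
      and eqs: "\<forall>\<tau>\<in>J. (u \<tau>)\<^sup>2 + (v \<tau>)\<^sup>2 < 1 \<and> xy_eqs J e0 e1 e2 \<nu>1 \<nu>2 x y \<tau> \<and>
        uv_eqs J e0 e1 e2 u v \<tau> \<and> phase_eq J k e0 e1 e2 \<nu>1 \<nu>2 x y u v \<phi> \<tau>"
      and t: "t / hbar \<in> J"
    for \<Phi> k x y u v \<phi> t
  proof -
    define \<tau> where "\<tau> = t / hbar"
    define g :: "real \<Rightarrow> jacobi" where "g s = ((Complex (x s) (y s), 0), siegel_matrix (Complex (u s) (v s)))" for s
    define c where "c s = exp (- \<i> * complex_of_real (\<phi> s))" for s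
    define \<alpha> w where "\<alpha> = Complex (x \<tau>) (y \<tau>)" and "w = Complex (u \<tau>) (v \<tau>)"
    define r where "r = complex_of_real (1 / sqrt (1 - (cmod w)\<^sup>2))"
    define \<rho> where "\<rho> = Im (\<epsilon>p \<tau> * cnj w)"
    define \<alpha>' where "\<alpha>' = - \<i> * (cnj (\<epsilon>a \<tau>) + e0 \<tau> * \<alpha> + \<epsilon>p \<tau> * cnj \<alpha>)"
    define w' where "w' = - \<i> * (\<epsilon>p \<tau> + 2 * e0 \<tau> * w + cnj (\<epsilon>p \<tau>) * w\<^sup>2)"
    \<comment> \<open>The scalar left over by \<open>hamiltonian_orbit\<close>; in real coefficients
      it is the right-hand side of the phase equation.\<close>
    define \<phi>' where "\<phi>' = Re (\<epsilon>a \<tau> * \<alpha>) + 2 * k * (e0 \<tau> + Re (\<epsilon>p \<tau> * cnj w))"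
    let ?V = "((\<alpha>', 0), mat2 (r * \<rho>) (r * \<rho> * w + r * w') (r * \<rho> * cnj w + r * cnj w') (r * \<rho>))"
    have \<tau>: "\<tau> \<in> J" using t by (simp add: \<tau>_def)
    have disk: "cmod (Complex (u s) (v s)) < 1" if "s \<in> J" for s
      using eqs that by (simp add: complex_norm real_less_lsqrt)
    have car: "g s \<in> carrier jacobi_group" if "s \<in> J" for s
      using siegel_matrix_SU11[OF disk[OF that]] by (simp add: g_def carrier_jacobi_iff)
    have T: "op_T \<pi> (?\<xi> x y u v s) \<Phi> = \<pi> (g s) \<Phi>" if "s \<in> J" for s
      using op_T_eq[OF ops disk[OF that]] by (simp add: g_def)
    from eqs \<tau> have xy\<tau>: "xy_eqs J e0 e1 e2 \<nu>1 \<nu>2 x y \<tau>" and uv\<tau>: "uv_eqs J e0 e1 e2 u v \<tau>"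
      and phase: "phase_eq J k e0 e1 e2 \<nu>1 \<nu>2 x y u v \<phi> \<tau>" and disk\<tau>: "(u \<tau>)\<^sup>2 + (v \<tau>)\<^sup>2 < 1"
      by blast+
    have d\<phi>: "(\<phi> has_real_derivative \<phi>') (at \<tau> within J)"
    proof -
      have "\<nu>1 \<tau> * x \<tau> - \<nu>2 \<tau> * y \<tau> + 2 * k * (e0 \<tau> + e1 \<tau> * u \<tau> - e2 \<tau> * v \<tau>) = \<phi>'"
        by (simp add: \<phi>'_def \<alpha>_def w_def \<nu> e12)
      then show ?thesis using phase by (simp only: phase_eq_def)
    qed
    have d\<alpha>: "((\<lambda>s. Complex (x s) (y s)) has_vector_derivative \<alpha>') (at \<tau> within J)"
      using xy\<tau> unfolding xy \<alpha>'_def \<alpha>_def by (simp only: add_ac)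
    have dM: "((\<lambda>s. siegel_matrix (Complex (u s) (v s))) has_vector_derivative
        mat2 (r * \<rho>) (r * \<rho> * w + r * w') (r * \<rho> * cnj w + r * cnj w') (r * \<rho>)) (at \<tau> within J)"
    proof -
      have "((\<lambda>s. Complex (u s) (v s)) has_vector_derivative w') (at \<tau> within J)"
        using uv\<tau> unfolding uv w'_def w_def .
      then have "(u has_real_derivative Re w') (at \<tau> within J)" "(v has_real_derivative Im w') (at \<tau> within J)"
        by (simp_all add: has_vector_derivative_complex_iff)
      \<comment> \<open>The left side is \<open>Re (cnj w * w')\<close>. In the Riccati equation the
        linear term drops out, and the constant and quadratic terms contribute \<open>\<rho>\<close>
        and \<open>- \<rho> * (cmod w)\<^sup>2\<close>.\<close>
      moreover have "u \<tau> * Re w' + v \<tau> * Im w' = \<rho> * (1 - (u \<tau>)\<^sup>2 - (v \<tau>)\<^sup>2)"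
        by (simp add: w'_def w_def \<rho>_def power2_eq_square algebra_simps)
      ultimately show ?thesis
        using siegel_matrix_has_vector_derivative[of u "Re w'" \<tau> J v "Im w'" \<rho>] disk\<tau>
        by (simp add: r_def w_def)
    qed
    have dg: "(g has_vector_derivative ?V) (at \<tau> within J)"
      unfolding g_def by (intro has_vector_derivative_Pair d\<alpha> dM has_vector_derivative_const)
    obtain L where L: "orbit_derivative \<pi> (g \<tau>) \<Phi> L"
      using orbit_derivative_exists[OF \<Phi>(1) car[OF \<tau>]] by blast
    have dc: "(c has_vector_derivative (- \<i> * \<phi>') * c \<tau>) (at \<tau> within J)"
    proof -
      have "((\<lambda>s. - \<i> * complex_of_real (\<phi> s)) has_vector_derivative - \<i> * \<phi>') (at \<tau> within J)"
        unfolding has_vector_derivative_complex_iff using d\<phi> by (auto intro!: derivative_eq_intros)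
      from field_vector_diff_chain_within[OF this has_field_derivative_at_within[OF DERIV_exp]]
      show ?thesis by (simp add: o_def c_def[abs_def])
    qed
    define D where "D = c \<tau> *\<^sub>C L ?V + ((- \<i> * \<phi>') * c \<tau>) *\<^sub>C \<pi> (g \<tau>) \<Phi>"
    have "((\<lambda>s. c s *\<^sub>C \<pi> (g s) \<Phi>) has_vector_derivative D) (at \<tau> within J)"
      unfolding D_def
      by (rule bounded_bilinear.has_vector_derivative[OF bounded_bilinear_scaleC dc
          orbit_derivativeD[OF L dg car \<tau> refl]])
    \<comment> \<open>The chain rule for the change from \<tau> to \<open>t\<close> requires the
      derivative within the image of \<open>?I\<close>, which lies in \<open>J\<close>.\<close>
    then have "((\<lambda>s. c s *\<^sub>C \<pi> (g s) \<Phi>) has_vector_derivative D) (at (t / hbar) within (\<lambda>t. t / hbar) ` ?I)"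
      unfolding \<tau>_def by (rule has_vector_derivative_within_subset) auto
    moreover have "((\<lambda>t. t / hbar) has_vector_derivative 1 / hbar) (at t within ?I)"
      by (auto intro!: derivative_eq_intros)
    ultimately have "((\<lambda>t. c (t / hbar) *\<^sub>C \<pi> (g (t / hbar)) \<Phi>) has_vector_derivative (1 / hbar) *\<^sub>R D) (at t within ?I)"
      using vector_diff_chain_within[of "\<lambda>t. t / hbar" "1 / hbar" t ?I "\<lambda>s. c s *\<^sub>C \<pi> (g s) \<Phi>" D]
      by (simp add: o_def)
    then have d\<Psi>: "(?\<Psi> \<Phi> x y u v \<phi> has_vector_derivative (1 / hbar) *\<^sub>R D) (at t within ?I)"
      by (rule has_vector_derivative_transform[rotated 2]) (use t T in \<open>simp_all add: c_def\<close>)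
    \<comment> \<open>At the fixed time the phase is absorbed into the vector:
      \<open>c \<tau> *\<^sub>C \<Phi>\<close> is again a smooth eigenvector for \<open>k\<close>,
      so \<open>hamiltonian_orbit\<close> applies to it directly.\<close>
    have \<Psi>: "?\<Psi> \<Phi> x y u v \<phi> t = \<pi> (g \<tau>) (c \<tau> *\<^sub>C \<Phi>)"
      using T[OF \<tau>] rep_scaleC[OF ops(1) car[OF \<tau>]] by (simp add: c_def \<tau>_def)
    have smooth: "c \<tau> *\<^sub>C \<Phi> \<in> smooth_vectors \<pi>"
      by (rule smooth_vectors_scaleC[OF ops(1) \<Phi>(1)])
    have "op_K0 \<pi> (c \<tau> *\<^sub>C \<Phi>) = complex_of_real k *\<^sub>C c \<tau> *\<^sub>C \<Phi>"
      by (simp add: op_K0_scaleC[OF ops(1) \<Phi>(1)] \<Phi>(2) scaleC_scaleC mult.commute)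
    note hamiltonian_orbit[OF ops(1) I smooth this disk[OF \<tau>, folded w_def]
        orbit_derivative_scaleC[OF ops(1) L[unfolded g_def, folded \<alpha>_def w_def], of "c \<tau>"],
        of "\<epsilon>a \<tau>" "e0 \<tau>" "\<epsilon>p \<tau>", folded r_def \<rho>_def \<alpha>'_def w'_def \<phi>'_def]
    then have "H0 \<tau> (\<pi> (g \<tau>) (c \<tau> *\<^sub>C \<Phi>)) = \<i> *\<^sub>C c \<tau> *\<^sub>C L ?V + complex_of_real \<phi>' *\<^sub>C \<pi> (g \<tau>) (c \<tau> *\<^sub>C \<Phi>)"
      by (simp only: H0 e0 \<epsilon>m[symmetric] g_def \<alpha>_def w_def)
    \<comment> \<open>The derivative of the phase factor brings down
      \<open>- \<i> * \<phi>'\<close>; multiplied by \<open>\<i>\<close> it is exactly the scalar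
      remainder.\<close>
    also have "\<dots> = \<i> *\<^sub>C D"
    proof -
      have "\<i> * ((- \<i> * \<phi>') * c \<tau>) = \<phi>' * c \<tau>" by (simp flip: mult.assoc)
      then show ?thesis
        by (simp only: D_def scaleC_add_right scaleC_scaleC rep_scaleC[OF ops(1) car[OF \<tau>]])
    qed
    also have "\<dots> = (\<i> * complex_of_real hbar) *\<^sub>C (1 / hbar) *\<^sub>R D"
      using hbar by (simp add: scaleR_conv_scaleC scaleC_scaleC)
    finally show ?thesis
      using d\<Psi> smooth_vectors_rep[OF ops(1) smooth car[OF \<tau>]] unfolding \<Psi> unfolding \<tau>_def[symmetric] by blast
  qed
  then show "\<forall>(\<Phi>::'h) (k::real) (x::real \<Rightarrow> real) y u v \<phi>.
       \<Phi> \<in> smooth_vectors \<pi> \<and> op_K0 \<pi> \<Phi> = complex_of_real k *\<^sub>C \<Phi> \<and>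
       (\<forall>\<tau>\<in>J. (u \<tau>)\<^sup>2 + (v \<tau>)\<^sup>2 < 1 \<and>
          xy_eqs J e0 e1 e2 \<nu>1 \<nu>2 x y \<tau> \<and> uv_eqs J e0 e1 e2 u v \<tau> \<and>
          phase_eq J k e0 e1 e2 \<nu>1 \<nu>2 x y u v \<phi> \<tau>) \<longrightarrow>
       (let \<xi> = (\<lambda>\<tau>. (Complex (x \<tau>) (y \<tau>), Complex (u \<tau>) (v \<tau>)));
            \<Psi> = (\<lambda>t. exp (- \<i> * complex_of_real (\<phi> (t / hbar))) *\<^sub>C op_T \<pi> (\<xi> (t / hbar)) \<Phi>);
            I = {t. t / hbar \<in> J}
        in \<forall>t\<in>I. \<Psi> t \<in> smooth_vectors \<pi> \<and>
             (\<exists>d\<Psi>. (\<Psi> has_vector_derivative d\<Psi>) (at t within I) \<and>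
                   H0 (t / hbar) (\<Psi> t) = (\<i> * complex_of_real hbar) *\<^sub>C d\<Psi>))"
    unfolding Let_def by blast
qed

end
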